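(* Let $T$ be a (possibly unbounded) self-adjoint operator on a Hilbert space $\mathcal{H}$, with bounded transform $S=T\sqrt{I+T^2}^{\,-1}$. The (point) spectra of $T$ and its bounded transform $S$ are related by $$\sigma(T)=\left\{\mu(1-\mu^2)^{-\frac{1}{2}} : \mu\in\tilde{\sigma}(S)\right\};$$ $$\sigma(S)=\left\{\lambda(1+\lambda^2)^{-\frac{1}{2}} : \lambda\in\sigma(T)\right\}^-,$$ where $\mbox{}^-$ denotes the closure in $\mathbb{R}$, and we abbreviate $\tilde{\sigma}(S)=\sigma(S)\cap(-1,1)$.
   Context: $\mathcal{H}$ is a Hilbert space and $T$ is an operator on $\mathcal{H}$ with $T^*=T$, possibly unbounded. Its bounded transform is $S=T\sqrt{I+T^2}^{\,-1}$, with inverse $T=S\sqrt{I-S^2}^{\,-1}$; this gives a bijective correspondence between self-adjoint operators $T$ and self-adjoint pure contractions $S$, i.e. self-adjoint $S$ with $\|Sx\|<\|x\|$ for each $x\in\mathcal{H}\setminus\{0\}$. $\sigma(\cdot)$ denotes the spectrum; the point spectrum is the set of eigenvalues.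
   Formalization: For point spectra the second formula is stated without the closure, since with it it fails: for T = diag(1/n) on ℓ², 0 lies in the closure but is not an eigenvalue of S; for the spectra both formulas are as displayed. *)

theory Defs
  imports "HOL-Analysis.Analysis"
begin

text \<open>
  A complex Hilbert space is a complete real inner product space carrying a compatible complex
  structure: real scalar multiplication is the restriction of the complex one and the real inner
  product is the real part of the complex one. Norm, topology and completeness are thus those of
  the library, and positive definiteness of \<open>cinner\<close> is inherited from that of \<open>inner\<close>.
  The complex inner product is linear in its second argument.
\<close>

class complex_hilbert = real_inner + complete_space +
  fixes scaleC :: "complex \<Rightarrow> 'a \<Rightarrow> 'a"  (infixr "*\<^sub>C" 75)
    and cinner :: "'a \<Rightarrow> 'a \<Rightarrow> complex"
  assumes scaleC_add_right: "c *\<^sub>C (x + y) = c *\<^sub>C x + c *\<^sub>C y"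
    and scaleC_add_left: "(c + d) *\<^sub>C x = c *\<^sub>C x + d *\<^sub>C x"
    and scaleC_scaleC: "c *\<^sub>C d *\<^sub>C x = (c * d) *\<^sub>C x"
    and scaleR_scaleC: "r *\<^sub>R x = complex_of_real r *\<^sub>C x"
    and cinner_commute: "cinner x y = cnj (cinner y x)"
    and cinner_add_right: "cinner x (y + z) = cinner x y + cinner x z"
    and cinner_scaleC_right: "cinner x (c *\<^sub>C y) = c * cinner x y"
    and inner_cinner: "inner x y = Re (cinner x y)"

instantiation complex :: complex_hilbert
begin

definition scaleC_complex :: "complex \<Rightarrow> complex \<Rightarrow> complex"
  where "scaleC_complex c x = c * x"

definition cinner_complex :: "complex \<Rightarrow> complex \<Rightarrow> complex"
  where "cinner_complex x y = cnj x * y"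

instance
  by standard
    (auto simp: scaleC_complex_def cinner_complex_def inner_complex_def algebra_simps
      scaleR_conv_of_real)

end


text \<open>
  A possibly unbounded operator is a partial function; its domain is \<open>dom T\<close>. Equality of
  operators therefore includes equality of domains. The product of two operators is
  \<open>A \<circ>\<^sub>m B\<close>, with domain \<open>{x \<in> dom B. B x \<in> dom A}\<close>; the identity operator is \<open>Some\<close>.
\<close>

type_synonym 'a operator = "'a \<Rightarrow> 'a option"

definition linear_operator :: "'a::complex_hilbert operator \<Rightarrow> bool"
  where "linear_operator T \<longleftrightarrow>
    T 0 = Some 0 \<and>
    (\<forall>x y u v. T x = Some u \<longrightarrow> T y = Some v \<longrightarrow> T (x + y) = Some (u + v)) \<and>
    (\<forall>c x u. T x = Some u \<longrightarrow> T (c *\<^sub>C x) = Some (c *\<^sub>C u))"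

definition op_plus :: "'a::complex_hilbert operator \<Rightarrow> 'a operator \<Rightarrow> 'a operator"
  where "op_plus A B = (\<lambda>x. case (A x, B x) of (Some u, Some v) \<Rightarrow> Some (u + v) | _ \<Rightarrow> None)"

definition scalar_op :: "complex \<Rightarrow> 'a::complex_hilbert operator"
  where "scalar_op z = (\<lambda>x. Some (z *\<^sub>C x))"

text \<open>The inverse is meaningful for injective operators only; its domain is then \<open>ran T\<close>.\<close>

definition op_inv :: "'a::complex_hilbert operator \<Rightarrow> 'a operator"
  where "op_inv T = (\<lambda>y. if \<exists>!x. T x = Some y then Some (THE x. T x = Some y) else None)"

text \<open>The vector \<open>z\<close> below is unique when \<open>dom T\<close> is dense.\<close>

definition adjoint_op :: "'a::complex_hilbert operator \<Rightarrow> 'a operator"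
  where "adjoint_op T = (\<lambda>y.
    if \<exists>z. \<forall>x\<in>dom T. cinner y (the (T x)) = cinner z x
    then Some (THE z. \<forall>x\<in>dom T. cinner y (the (T x)) = cinner z x)
    else None)"

definition self_adjoint :: "'a::complex_hilbert operator \<Rightarrow> bool"
  where "self_adjoint T \<longleftrightarrow>
    linear_operator T \<and> closure (dom T) = UNIV \<and> adjoint_op T = T"

definition positive_op :: "'a::complex_hilbert operator \<Rightarrow> bool"
  where "positive_op T \<longleftrightarrow> (\<forall>x\<in>dom T. cinner x (the (T x)) \<in> \<real>\<^sub>\<ge>\<^sub>0)"

text \<open>
  The positive square root of a positive self-adjoint operator: it is the unique positive
  self-adjoint operator whose square, domain included, is the given one.
\<close>

definition op_sqrt :: "'a::complex_hilbert operator \<Rightarrow> 'a operator"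
  where "op_sqrt A = (THE R. self_adjoint R \<and> positive_op R \<and> R \<circ>\<^sub>m R = A)"

definition bounded_transform :: "'a::complex_hilbert operator \<Rightarrow> 'a operator"
  where "bounded_transform T = T \<circ>\<^sub>m op_inv (op_sqrt (op_plus Some (T \<circ>\<^sub>m T)))"

text \<open>
  \<open>z\<close> is in the resolvent set iff \<open>T - z\<close> is a bijection from \<open>dom T\<close> onto the whole space
  with bounded inverse \<open>B\<close>.
\<close>

definition resolvent_set :: "'a::complex_hilbert operator \<Rightarrow> complex set"
  where "resolvent_set T = {z. \<exists>B. bounded_linear B \<and>
    op_plus T (scalar_op (- z)) \<circ>\<^sub>m (Some \<circ> B) = Some \<and>
    (Some \<circ> B) \<circ>\<^sub>m op_plus T (scalar_op (- z)) = Some |` dom T}"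

definition spectrum :: "'a::complex_hilbert operator \<Rightarrow> complex set"
  where "spectrum T = - resolvent_set T"

definition point_spectrum :: "'a::complex_hilbert operator \<Rightarrow> complex set"
  where "point_spectrum T = {z. \<exists>x. x \<noteq> 0 \<and> T x = Some (z *\<^sub>C x)}"

end

theory Submission
  imports Defs
begin

text \<open>
  No functional calculus is needed. Put \<open>B = (1 + T\<^sup>2)\<^sup>-\<^sup>1\<close>, which exists because the graph of \<open>T\<close> has an
  orthogonal projection, let \<open>C\<close> be its positive square root and \<open>S = T C\<close>. Then \<open>S\<close> and \<open>C\<close> are
  commuting bounded symmetric operators with \<open>S\<^sup>2 + C\<^sup>2 = 1\<close>, and \<open>T = S C\<^sup>-\<^sup>1\<close>. For self-adjoint operators
  the resolvent set is where the shift by \<open>z\<close> is bounded below, and for \<open>\<mu> \<in> (-1, 1)\<close>,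
  \<open>c = \<surd>(1 - \<mu>\<^sup>2)\<close>, \<open>\<tau> = \<mu> / c\<close> the identity \<open>c (C + c) (S - \<tau> C) = (1 + c C + \<mu> S) (S - \<mu>)\<close>, whose outer
  factors are positive and invertible, shows that \<open>T - \<tau>\<close> and \<open>S - \<mu>\<close> are bounded below, or
  injective, simultaneously. Finally \<open>\<plusminus>1\<close> cannot be isolated points of the spectrum of \<open>S\<close>, since they
  would be eigenvalues, contradicting injectivity of \<open>C\<^sup>2 = 1 - S\<^sup>2\<close>.
\<close>

section \<open>Bounded symmetric operators on real Hilbert spaces\<close>

text \<open>The complex structure is kept at a distance. Since the domain is stable under
  multiplication by the imaginary unit, self-adjointness is the same condition for the real part of
  the inner product, so \<open>C\<close> and \<open>S\<close> can be built over a real Hilbert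
  space. Complex linearity returns at the end, because \<open>C\<close> commutes with every bounded
  map that commutes with \<open>B\<close>.

  The identity of the overview is trigonometric. Read \<open>S\<close> and \<open>C\<close> as sine
  and cosine of one angle \<theta>, and put \<mu> = sin \<alpha>, c = cos \<alpha>. It is then the
  half-angle formula (sin \<theta> - sin \<alpha>) / (cos \<theta> + cos \<alpha>) = tan ((\<theta>
  - \<alpha>) / 2) = sin (\<theta> - \<alpha>) / (1 + cos (\<theta> - \<alpha>)), cleared of
  denominators. Clearing them avoids the possibly unbounded inverse of \<open>C\<close>.

  At an isolated endpoint the spectral theorem would supply an eigenvector. Here a gap in the
  spectrum below 1 becomes an operator inequality, and this bounds 1 - S from below.\<close>

lemma closed_subspace_projection:
  fixes M :: "'a::{real_inner,banach} set"
  assumes "subspace M" "closed M"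
  obtains q where "q \<in> M" "\<And>m. m \<in> M \<Longrightarrow> inner (p - q) m = 0"
proof -
  have ne: "M \<noteq> {}" using subspace_0[OF assms(1)] by blast
  define d where "d = infdist p M"
  have d0: "d \<ge> 0" by (simp add: d_def infdist_nonneg)
  have dle: "d \<le> norm (p - m)" if "m \<in> M" for m
    using infdist_le[OF that, of p] by (simp add: d_def dist_norm)
  have "\<exists>m\<in>M. norm (p - m) < d + inverse (real (Suc n))" for n
  proof (rule ccontr)
    assume "\<not> ?thesis"
    then have "d + inverse (real (Suc n)) \<le> infdist p M"
      unfolding infdist_notempty[OF ne] using ne by (intro cINF_greatest) (auto simp: dist_norm not_less)
    then show False unfolding d_def
      by (metis add_le_same_cancel1 inverse_positive_iff_positive not_le of_nat_0_less_iff zero_less_Suc)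
  qed
  then obtain m where mM: "\<And>n. m n \<in> M" and m: "\<And>n. norm (p - m n) < d + inverse (real (Suc n))"
    by metis
  \<comment> \<open>Parallelogram law for \<open>p - a\<close> and \<open>p - b\<close>: the
    midpoint of \<open>a\<close> and \<open>b\<close> lies in \<open>M\<close>, hence at distance at
    least \<open>d\<close> from \<open>p\<close>.\<close>
  have para: "(norm (a - b))\<^sup>2 \<le> 2 * ((norm (p - a))\<^sup>2 - d\<^sup>2) + 2 * ((norm (p - b))\<^sup>2 - d\<^sup>2)"
    if "a \<in> M" "b \<in> M" for a b
  proof -
    have "(1/2) *\<^sub>R (a + b) \<in> M" using that assms(1) by (simp add: subspace_add subspace_scale)
    then have "d \<le> norm (p - (1/2) *\<^sub>R (a + b))" by (rule dle)
    then have "d\<^sup>2 \<le> (norm (p - (1/2) *\<^sub>R (a + b)))\<^sup>2" using d0 by (simp add: power_mono)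
    then show ?thesis
      by (simp add: power2_norm_eq_inner inner_diff_left inner_diff_right inner_add_left inner_add_right
          inner_commute algebra_simps)
  qed
  \<comment> \<open>For i \<le> 1, (d + i)^2 - d^2 = 2 d i + i^2 \<le> (2 d + 1) i.\<close>
  have sq: "(norm (p - m n))\<^sup>2 - d\<^sup>2 \<le> (2 * d + 1) * inverse (real (Suc n))" for n
  proof -
    define i where "i = inverse (real (Suc n))"
    have i: "0 < i" "i \<le> 1" by (simp_all add: i_def inverse_le_1_iff)
    have "(norm (p - m n))\<^sup>2 \<le> (d + i)\<^sup>2" using m[of n] by (intro power_mono) (auto simp: i_def)
    moreover have "i * i \<le> i * 1" using i by (intro mult_left_mono) auto
    ultimately show ?thesis unfolding i_def[symmetric] by (simp add: power2_eq_square algebra_simps)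
  qed
  have lim0: "(\<lambda>n. (2 * d + 1) * inverse (real (Suc n))) \<longlonglongrightarrow> 0"
    using tendsto_mult_left[OF LIMSEQ_inverse_real_of_nat, of "2*d+1"] by simp
  have "Cauchy m"
  proof (rule CauchyI)
    fix e :: real assume "e > 0"
    \<comment> \<open>\<open>para\<close> has two terms with factor 2, so each may contribute a
      quarter.\<close>
    then have "e\<^sup>2 / 4 > 0" by simp
    then obtain N where N: "\<And>n. n \<ge> N \<Longrightarrow> (2 * d + 1) * inverse (real (Suc n)) < e\<^sup>2 / 4"
      using order_tendstoD(2)[OF lim0] unfolding eventually_sequentially by blast
    have "norm (m i - m j) < e" if "i \<ge> N" "j \<ge> N" for i j
    proof -
      have "(norm (m i - m j))\<^sup>2 < e\<^sup>2"
        using para[OF mM mM, of i j] le_less_trans[OF sq N[OF that(1)]] le_less_trans[OF sq N[OF that(2)]]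
        by argo
      then show ?thesis using \<open>e > 0\<close> by (simp add: power_less_imp_less_base)
    qed
    then show "\<exists>M. \<forall>i\<ge>M. \<forall>j\<ge>M. norm (m i - m j) < e" by blast
  qed
  then obtain q where q: "m \<longlonglongrightarrow> q" using convergent_eq_Cauchy by blast
  have qM: "q \<in> M" using closed_sequentially[OF assms(2) mM q] .
  have "(\<lambda>n. norm (p - m n)) \<longlonglongrightarrow> norm (p - q)" by (intro tendsto_intros q)
  moreover have "(\<lambda>n. d + inverse (real (Suc n))) \<longlonglongrightarrow> d + 0"
    by (intro tendsto_intros LIMSEQ_inverse_real_of_nat)
  ultimately have "norm (p - q) \<le> d + 0"
    using m less_imp_le by (intro LIMSEQ_le) blast+
  then have nq: "norm (p - q) = d" using dle[OF qM] by simp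
  show ?thesis
  proof
    show "q \<in> M" by (rule qM)
    fix v assume v: "v \<in> M"
    let ?c = "inner (p - q) v"
    show "?c = 0"
    proof (cases "v = 0")
      case False
      \<comment> \<open>\<open>t *\<^sub>R v\<close> is the projection of \<open>p - q\<close> to
        the line of \<open>v\<close>; adding it to \<open>q\<close> would lower the squared distance
        by \<open>?c\<^sup>2 / inner v v\<close>.\<close>
      define t where "t = ?c / inner v v"
      have pos: "inner v v > 0" using False by simp
      have "q + t *\<^sub>R v \<in> M" using qM v assms(1) by (simp add: subspace_add subspace_scale)
      from dle[OF this] have "(norm (p - q))\<^sup>2 \<le> (norm ((p - q) - t *\<^sub>R v))\<^sup>2"
        using nq d0 by (simp add: power_mono diff_diff_add)
      then have "2 * (t * ?c) \<le> t * (t * inner v v)"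
        by (simp only: power2_norm_eq_inner inner_diff_left inner_diff_right inner_scaleR_left
            inner_scaleR_right) (simp add: inner_commute algebra_simps)
      moreover have "t * inner v v = ?c" using pos by (simp add: t_def)
      ultimately have "t * ?c \<le> 0" by simp
      then have "?c\<^sup>2 \<le> 0" using pos by (simp add: t_def power2_eq_square divide_le_0_iff mult_le_0_iff)
      then show ?thesis by simp
    qed simp
  qed
qed

lemma subspace_closure:
  fixes M :: "'a::real_normed_vector set"
  assumes "subspace M"
  shows "subspace (closure M)"
  unfolding subspace_def
proof (intro conjI ballI allI)
  show "0 \<in> closure M" using closure_subset subspace_0[OF assms] by blast
next
  fix x y assume "x \<in> closure M" "y \<in> closure M"
  then obtain f g where "\<forall>n. f n \<in> M" "f \<longlonglongrightarrow> x" "\<forall>n. g n \<in> M" "g \<longlonglongrightarrow> y"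
    unfolding closure_sequential by blast
  then have "\<forall>n. f n + g n \<in> M" "(\<lambda>n. f n + g n) \<longlonglongrightarrow> x + y"
    using subspace_add[OF assms] by (auto intro: tendsto_add)
  then show "x + y \<in> closure M" unfolding closure_sequential by (intro exI conjI)
next
  fix c :: real and x assume "x \<in> closure M"
  then obtain f where "\<forall>n. f n \<in> M" "f \<longlonglongrightarrow> x" unfolding closure_sequential by blast
  then have "\<forall>n. c *\<^sub>R f n \<in> M" "(\<lambda>n. c *\<^sub>R f n) \<longlonglongrightarrow> c *\<^sub>R x"
    using subspace_scale[OF assms] by (auto intro: tendsto_scaleR)
  then show "c *\<^sub>R x \<in> closure M" unfolding closure_sequential by (intro exI conjI)
qed

text \<open>A point outside the closure would leave a nonzero residual of its projection, orthogonal
  to \<open>M\<close>.\<close>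

lemma dense_subspace_if_orthogonal_trivial:
  fixes M :: "'a::{real_inner,banach} set"
  assumes "subspace M" and orth: "\<And>w. (\<And>m. m \<in> M \<Longrightarrow> inner w m = 0) \<Longrightarrow> w = 0"
  shows "closure M = UNIV"
proof (rule ccontr)
  assume "closure M \<noteq> UNIV"
  then obtain p where p: "p \<notin> closure M" by blast
  obtain q where q: "q \<in> closure M" "\<And>m. m \<in> closure M \<Longrightarrow> inner (p - q) m = 0"
    using closed_subspace_projection[OF subspace_closure[OF assms(1)] closed_closure] by blast
  then have "p - q = 0" using orth closure_subset by blast
  then show False using p q(1) by simp
qed

section \<open>Symmetric maps and their quadratic forms\<close>

definition symmetric_map :: "('a::real_inner \<Rightarrow> 'a) \<Rightarrow> bool"
  where "symmetric_map A \<longleftrightarrow> bounded_linear A \<and> (\<forall>x y. inner (A x) y = inner x (A y))"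

text \<open>Usually called bounded below. For self-adjoint operators this alone characterises the
  resolvent set, see \<open>resolvent_set_iff\<close>.\<close>

definition expansive :: "('a::real_normed_vector \<Rightarrow> 'a) \<Rightarrow> bool"
  where "expansive A \<longleftrightarrow> (\<exists>e>0. \<forall>x. e * norm x \<le> norm (A x))"

lemma symmetric_mapD:
  assumes "symmetric_map A"
  shows "bounded_linear A" "inner (A x) y = inner x (A y)"
    "A (x + y) = A x + A y" "A (x - y) = A x - A y" "A (r *\<^sub>R x) = r *\<^sub>R A x" "A 0 = 0" "A (- x) = - A x"
  using assms by (auto simp: symmetric_map_def linear_simps)

lemma symmetric_map_affine:
  assumes "symmetric_map A"
  shows "symmetric_map (\<lambda>x. r *\<^sub>R A x + s *\<^sub>R x)"
  unfolding symmetric_map_def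
proof
  have "bounded_linear A" using assms by (rule symmetric_mapD)
  then show "bounded_linear (\<lambda>x. r *\<^sub>R A x + s *\<^sub>R x)"
    by (intro bounded_linear_add bounded_linear_const_scaleR bounded_linear_ident)
  show "\<forall>x y. inner (r *\<^sub>R A x + s *\<^sub>R x) y = inner x (r *\<^sub>R A y + s *\<^sub>R y)"
    using symmetric_mapD(2)[OF assms] by (simp add: inner_add_left inner_add_right)
qed

text \<open>If \<open>w\<close> is orthogonal to the range, testing against \<open>A (A w)\<close>
  gives A w = 0.\<close>

lemma symmetric_map_dense_range:
  fixes A :: "'a::{real_inner,banach} \<Rightarrow> 'a"
  assumes "symmetric_map A" and inj: "\<And>x. A x = 0 \<Longrightarrow> x = 0"
  shows "closure (range A) = UNIV"
proof (rule dense_subspace_if_orthogonal_trivial)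
  have "linear A" using assms(1) by (simp add: symmetric_mapD bounded_linear.linear)
  then show "subspace (range A)" by (simp add: linear_subspace_image)
  fix w assume "\<And>m. m \<in> range A \<Longrightarrow> inner w m = 0"
  then have "inner w (A (A w)) = 0" by blast
  then have "inner (A w) (A w) = 0" by (simp add: symmetric_mapD(2)[OF assms(1)])
  then show "w = 0" using inj by simp
qed

lemma form_Cauchy_Schwarz:
  assumes A: "symmetric_map A" and pos: "\<And>x. 0 \<le> inner (A x) x"
  shows "(inner (A x) y)\<^sup>2 \<le> inner (A x) x * inner (A y) y"
proof -
  note s = symmetric_mapD[OF A]
  define a b c where "a = inner (A x) x" "b = inner (A x) y" "c = inner (A y) y"
  have b': "inner (A y) x = b" using s(2) by (simp add: a_b_c_def inner_commute)
  have q: "0 \<le> r * r * a + 2 * r * t * b + t * t * c" for r t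
    using pos[of "r *\<^sub>R x + t *\<^sub>R y"] b'
    by (simp add: s(3,5) inner_add_left inner_add_right a_b_c_def[symmetric] algebra_simps)
  have ac: "a \<ge> 0" "c \<ge> 0" using pos by (simp_all add: a_b_c_def)
  have "b\<^sup>2 \<le> a * c"
  proof (cases "c = 0")
    case True
    show ?thesis
    proof (rule ccontr)
      assume "\<not> ?thesis"
      then have "b \<noteq> 0" using ac True by auto
      \<comment> \<open>With c = 0 the quadratic is affine in \<open>t\<close>, and this
        \<open>t\<close> makes it -1.\<close>
      then show False using q[of 1 "- (a + 1) / (2 * b)"] True by (simp add: field_simps)
    qed
  next
    case False
    then have "0 < c" using ac by simp
    \<comment> \<open>These coefficients minimise the quadratic up to scaling, so its value there is
      \<open>c\<close> times the discriminant gap.\<close>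
    have "0 \<le> c * (a * c - b\<^sup>2)" using q[of c "-b"] by (simp add: power2_eq_square algebra_simps)
    then show ?thesis using \<open>0 < c\<close> by (simp add: zero_le_mult_iff)
  qed
  then show ?thesis by (simp add: a_b_c_def)
qed

text \<open>Cauchy-Schwarz for the form, with y = A x. It makes \<open>A x\<close> small whenever
  the form at \<open>x\<close> is small, and zero when the form vanishes.\<close>

lemma form_norm_bound:
  assumes A: "symmetric_map A" and pos: "\<And>x. 0 \<le> inner (A x) x"
  obtains K where "K > 0" "\<And>x. (norm (A x))\<^sup>2 \<le> K * inner (A x) x"
proof -
  obtain K where K: "K > 0" "\<And>x. norm (A x) \<le> norm x * K"
    using bounded_linear.pos_bounded[OF symmetric_mapD(1)[OF A]] by blast
  have "(norm (A x))\<^sup>2 \<le> K * inner (A x) x" for x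
  proof (cases "A x = 0")
    case False
    have "inner (A (A x)) (A x) \<le> norm (A (A x)) * norm (A x)" by (rule norm_cauchy_schwarz)
    also have "\<dots> \<le> (norm (A x) * K) * norm (A x)" using K(2) by (intro mult_right_mono) auto
    finally have 1: "inner (A (A x)) (A x) \<le> K * (norm (A x))\<^sup>2"
      by (simp add: power2_eq_square mult_ac)
    have "((norm (A x))\<^sup>2)\<^sup>2 \<le> inner (A x) x * inner (A (A x)) (A x)"
      using form_Cauchy_Schwarz[OF A pos, of x "A x"] by (simp add: power2_norm_eq_inner)
    also have "\<dots> \<le> inner (A x) x * (K * (norm (A x))\<^sup>2)" using 1 pos by (intro mult_left_mono) auto
    finally have "(norm (A x))\<^sup>2 * (norm (A x))\<^sup>2 \<le> (norm (A x))\<^sup>2 * (K * inner (A x) x)"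
      by (simp only: power2_eq_square mult_ac)
    then show ?thesis by (rule mult_left_le_imp_le) (use False in simp)
  qed (use K pos in simp)
  then show ?thesis using K(1) that by blast
qed

section \<open>Positive square roots\<close>

lemma positive_sqrt_unique:
  assumes C: "symmetric_map C" "\<And>x. 0 \<le> inner (C x) x"
    and D: "symmetric_map D" "\<And>x. 0 \<le> inner (D x) x"
    and sq: "\<And>x. C (C x) = D (D x)" and comm: "\<And>x. C (D x) = D (C x)"
  shows "C x = D x"
proof -
  note c = symmetric_mapD[OF C(1)] and d = symmetric_mapD[OF D(1)]
  define y where "y = C x - D x"
  \<comment> \<open>(C + D) (C - D) = C^2 - D^2 by commutation. Two nonnegative forms with sum zero
    both vanish at \<open>y\<close>.\<close>
  have "C y + D y = 0" by (simp add: y_def c d sq comm)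
  then have "inner (C y) y + inner (D y) y = 0" by (metis inner_add_left inner_zero_left)
  then have z: "inner (C y) y = 0" "inner (D y) y = 0"
    using C(2)[of y] D(2)[of y] by linarith+
  obtain K where "(norm (C y))\<^sup>2 \<le> K * inner (C y) y" using form_norm_bound[OF C] by metis
  then have Cy: "C y = 0" using z by simp
  obtain K where "(norm (D y))\<^sup>2 \<le> K * inner (D y) y" using form_norm_bound[OF D] by metis
  then have Dy: "D y = 0" using z by simp
  have "inner y y = inner x (C y - D y)" by (simp add: y_def c(2) d(2) inner_diff_left inner_diff_right c(4) d(4))
  then show ?thesis using Cy Dy by (simp add: y_def)
qed

text \<open>
  Visser's iteration \<open>Y \<mapsto> (A + Y\<^sup>2) / 2\<close> with \<open>A = 1 - B\<close> has limit \<open>1 - \<surd>B\<close>; its increments are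
  dominated by those of the same iteration for the number \<open>1\<close>, which is monotone and bounded.
\<close>

primrec sqrt_iter :: "('a::real_vector \<Rightarrow> 'a) \<Rightarrow> nat \<Rightarrow> 'a \<Rightarrow> 'a"
  where "sqrt_iter A 0 = (\<lambda>x. 0)"
  | "sqrt_iter A (Suc n) = (\<lambda>x. (1/2) *\<^sub>R (A x + sqrt_iter A n (sqrt_iter A n x)))"

primrec sqrt_majorant :: "nat \<Rightarrow> real"
  where "sqrt_majorant 0 = 0"
  | "sqrt_majorant (Suc n) = (1 + (sqrt_majorant n)\<^sup>2) / 2"

lemma sqrt_majorant_bounds: "0 \<le> sqrt_majorant n" "sqrt_majorant n \<le> 1"
  by (induction n) (auto simp: abs_square_le_1)

lemma sqrt_majorant_mono: "sqrt_majorant n \<le> sqrt_majorant (Suc n)"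
proof -
  have "0 \<le> (1 - sqrt_majorant n)\<^sup>2" by simp
  then show ?thesis by (simp add: power2_diff algebra_simps)
qed

lemma bounded_linear_sqrt_iter:
  assumes "bounded_linear A" shows "bounded_linear (sqrt_iter A n)"
proof (induction n)
  case (Suc n)
  show ?case using bounded_linear_compose[OF Suc Suc] assms
    by (simp add: o_def) (intro bounded_linear_const_scaleR bounded_linear_add)
qed (simp add: bounded_linear_zero)

lemma norm_sqrt_iter_le:
  assumes A: "\<And>x. norm (A x) \<le> norm x"
  shows "norm (sqrt_iter A n x) \<le> sqrt_majorant n * norm x"
proof (induction n arbitrary: x)
  case (Suc n)
  have "norm (sqrt_iter A n (sqrt_iter A n x)) \<le> sqrt_majorant n * norm (sqrt_iter A n x)" by (rule Suc)
  also have "\<dots> \<le> sqrt_majorant n * (sqrt_majorant n * norm x)"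
    using Suc sqrt_majorant_bounds by (intro mult_left_mono) auto
  finally have "norm (A x + sqrt_iter A n (sqrt_iter A n x)) \<le> norm x + (sqrt_majorant n)\<^sup>2 * norm x"
    using norm_triangle_ineq[of "A x" "sqrt_iter A n (sqrt_iter A n x)"] A[of x]
    by (simp add: power2_eq_square mult.assoc)
  then show ?case by (simp add: ring_distribs del: scaleR_add_right)
qed simp

lemma norm_sqrt_iter_diff_le:
  assumes bl: "bounded_linear A" and A: "\<And>x. norm (A x) \<le> norm x"
  shows "norm (sqrt_iter A (Suc n) x - sqrt_iter A n x) \<le>
    (sqrt_majorant (Suc n) - sqrt_majorant n) * norm x"
proof (induction n arbitrary: x)
  case 0
  show ?case using A[of x] by simp
next
  case (Suc n)
  let ?Y = "sqrt_iter A (Suc n)" and ?Z = "sqrt_iter A n"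
  let ?y = "sqrt_majorant (Suc n)" and ?z = "sqrt_majorant n"
  have Z: "?Z (?Y x - ?Z x) = ?Z (?Y x) - ?Z (?Z x)"
    using bounded_linear_sqrt_iter[OF bl] by (rule linear_simps)
  have "sqrt_iter A (Suc (Suc n)) x - ?Y x = (1/2) *\<^sub>R (?Y (?Y x) - ?Z (?Z x))"
    by (simp add: algebra_simps)
  \<comment> \<open>Y^2 - Z^2 = (Y - Z) Y + Z (Y - Z): each summand has one increment and one factor
    bounded by the majorant, and the bounds recombine to
    \<open>?y\<^sup>2 - ?z\<^sup>2\<close>.\<close>
  also have "?Y (?Y x) - ?Z (?Z x) = (?Y (?Y x) - ?Z (?Y x)) + ?Z (?Y x - ?Z x)"
    using Z by simp
  finally have "norm (sqrt_iter A (Suc (Suc n)) x - ?Y x) \<le>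
      (1/2) * (norm (?Y (?Y x) - ?Z (?Y x)) + norm (?Z (?Y x - ?Z x)))"
    by (simp del: sqrt_iter.simps add: norm_triangle_ineq)
  also have "\<dots> \<le> (1/2) * ((?y - ?z) * (?y * norm x) + ?z * ((?y - ?z) * norm x))"
  proof -
    have "norm (?Y (?Y x) - ?Z (?Y x)) \<le> (?y - ?z) * norm (?Y x)" by (rule Suc)
    also have "\<dots> \<le> (?y - ?z) * (?y * norm x)"
      using norm_sqrt_iter_le[OF A, of "Suc n" x] sqrt_majorant_mono[of n]
      by (intro mult_left_mono) (simp_all del: sqrt_iter.simps sqrt_majorant.simps)
    finally have 1: "norm (?Y (?Y x) - ?Z (?Y x)) \<le> (?y - ?z) * (?y * norm x)" .
    have "norm (?Z (?Y x - ?Z x)) \<le> ?z * norm (?Y x - ?Z x)" by (rule norm_sqrt_iter_le[OF A])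
    also have "\<dots> \<le> ?z * ((?y - ?z) * norm x)"
      using Suc[of x] sqrt_majorant_bounds[of n] by (intro mult_left_mono) auto
    finally show ?thesis using 1 by (simp del: sqrt_iter.simps sqrt_majorant.simps)
  qed
  also have "\<dots> = ((?y\<^sup>2 - ?z\<^sup>2) / 2) * norm x"
    by (simp del: sqrt_iter.simps sqrt_majorant.simps add: power2_eq_square algebra_simps)
  also have "(?y\<^sup>2 - ?z\<^sup>2) / 2 = sqrt_majorant (Suc (Suc n)) - ?y" by simp argo
  finally show ?case .
qed

lemma sqrt_iter_commute:
  assumes M: "bounded_linear M" and "\<And>x. A (M x) = M (A x)"
  shows "sqrt_iter A n (M x) = M (sqrt_iter A n x)"
  by (induction n arbitrary: x) (use assms linear_simps[OF M] in auto)

lemma sqrt_iter_symmetric: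
  assumes "\<And>x y. inner (A x) y = inner x (A y)"
  shows "inner (sqrt_iter A n x) y = inner x (sqrt_iter A n y)"
  by (induction n arbitrary: x y) (simp_all add: inner_add_left inner_add_right assms)

text \<open>The last conclusion holds since every iterate is a polynomial in 1 - B. It serves three
  times: for complex linearity of the root, for its commutation with \<open>S\<close>, and for its
  uniqueness among positive roots.\<close>

lemma positive_sqrt_exists:
  fixes B :: "'a::{real_inner,banach} \<Rightarrow> 'a"
  assumes B: "symmetric_map B" and contr: "\<And>x. norm (x - B x) \<le> norm x"
  obtains C where "symmetric_map C" "\<And>x. 0 \<le> inner (C x) x" "\<And>x. C (C x) = B x"
    "\<And>M x. bounded_linear M \<Longrightarrow> (\<And>y. B (M y) = M (B y)) \<Longrightarrow> C (M x) = M (C x)"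
proof -
  note b = symmetric_mapD[OF B]
  define A where "A = (\<lambda>x. x - B x)"
  have A1: "norm (A x) \<le> norm x" for x using contr by (simp add: A_def)
  have Abl: "bounded_linear A" unfolding A_def using b(1) by (intro bounded_linear_sub bounded_linear_ident)
  have Asym: "inner (A x) y = inner x (A y)" for x y
    by (simp add: A_def inner_diff_left inner_diff_right b(2))
  let ?Y = "sqrt_iter A"
  note Ybl = bounded_linear_sqrt_iter[OF Abl]
  have maj: "convergent sqrt_majorant"
  proof (rule Bseq_mono_convergent)
    show "Bseq sqrt_majorant" using sqrt_majorant_bounds by (intro BseqI'[of _ 1]) auto
    show "\<forall>m n. m \<le> n \<longrightarrow> sqrt_majorant m \<le> sqrt_majorant n"
      using lift_Suc_mono_le[of sqrt_majorant, OF sqrt_majorant_mono] by blast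
  qed
  have diff: "norm (?Y (n + k) x - ?Y n x) \<le> (sqrt_majorant (n + k) - sqrt_majorant n) * norm x" for n k x
  proof (induction k)
    case (Suc k)
    have "norm (?Y (n + Suc k) x - ?Y n x) \<le>
        norm (?Y (Suc (n + k)) x - ?Y (n + k) x) + norm (?Y (n + k) x - ?Y n x)"
      by (metis add_Suc_right diff_add_cancel add_diff_eq norm_triangle_ineq)
    then show ?case using Suc norm_sqrt_iter_diff_le[OF Abl A1, of "n+k" x]
      by (simp del: sqrt_iter.simps sqrt_majorant.simps add: algebra_simps)
  qed simp
  have conv: "convergent (\<lambda>n. ?Y n x)" for x
  proof -
    have "Cauchy (\<lambda>n. ?Y n x)"
      unfolding Cauchy_altdef2 Cauchy_altdef
    proof (intro allI impI)
      fix e :: real assume e: "e > 0"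
      \<comment> \<open>The summand 1 covers x = 0.\<close>
      let ?e = "e / (norm x + 1)"
      have e': "?e > 0" using e by (simp add: add_nonneg_pos)
      have "Cauchy sqrt_majorant" using maj by (rule convergent_Cauchy)
      then obtain N where N: "\<And>m n. m \<ge> N \<Longrightarrow> n \<ge> N \<Longrightarrow> norm (sqrt_majorant m - sqrt_majorant n) < ?e"
        using CauchyD[OF _ e'] by metis
      have "dist (?Y m x) (?Y N x) < e" if mN: "m \<ge> N" for m
      proof -
        obtain k where k: "m = N + k" using le_Suc_ex[OF mN] by blast
        have "norm (?Y m x - ?Y N x) \<le> (sqrt_majorant m - sqrt_majorant N) * norm x"
          unfolding k by (rule diff)
        also have "\<dots> \<le> ?e * norm x" using N[OF that order_refl] by (intro mult_right_mono) auto
        also have "\<dots> < ?e * (norm x + 1)" using e' by (intro mult_strict_left_mono) auto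
        also have "\<dots> = e" using norm_ge_zero[of x] by (simp add: add_nonneg_eq_0_iff)
        finally show ?thesis by (simp add: dist_norm)
      qed
      then show "\<exists>N. \<forall>n\<ge>N. dist (?Y n x) (?Y N x) < e" by blast
    qed
    then show ?thesis by (simp add: Cauchy_convergent_iff)
  qed
  define Z where "Z x = lim (\<lambda>n. ?Y n x)" for x
  have Zl: "(\<lambda>n. ?Y n x) \<longlonglongrightarrow> Z x" for x
    using conv unfolding Z_def by (simp add: convergent_LIMSEQ_iff)
  have Yle: "norm (?Y n x) \<le> norm x" for n x
    using norm_sqrt_iter_le[OF A1, of n x] mult_right_mono[OF sqrt_majorant_bounds(2) norm_ge_zero, of n x]
    by linarith
  have Zle: "norm (Z x) \<le> norm x" for x
    using Yle by (intro LIMSEQ_le_const2[OF tendsto_norm[OF Zl]]) blast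
  have Zadd: "Z (x + y) = Z x + Z y" for x y
    using LIMSEQ_unique[OF Zl[of "x+y"]] tendsto_add[OF Zl[of x] Zl[of y]]
    by (simp add: linear_simps[OF Ybl])
  have Zscale: "Z (r *\<^sub>R x) = r *\<^sub>R Z x" for x r
    using LIMSEQ_unique[OF Zl[of "r *\<^sub>R x"]] tendsto_scaleR[OF tendsto_const Zl[of x], of r]
    by (simp add: linear_simps[OF Ybl])
  have Zbl: "bounded_linear Z"
    using Zadd Zscale Zle by (intro bounded_linear_intro[of _ 1]) auto
  have Zsym: "inner (Z x) y = inner x (Z y)" for x y
    using LIMSEQ_unique[OF tendsto_inner[OF Zl[of x] tendsto_const, of y]]
      tendsto_inner[OF tendsto_const Zl[of y], of x]
    by (simp add: sqrt_iter_symmetric[OF Asym])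
  \<comment> \<open>Equivalently, (1 - Z)^2 = 1 - A = B.\<close>
  have Zfix: "2 *\<^sub>R Z x = A x + Z (Z x)" for x
  proof -
    \<comment> \<open>Convergence is used pointwise only; the moving argument is absorbed by the
      uniform bound \<open>Yle\<close>.\<close>
    have "(\<lambda>n. ?Y n (?Y n x) - ?Y n (Z x)) \<longlonglongrightarrow> 0"
    proof (rule Lim_null_comparison)
      show "\<forall>\<^sub>F n in sequentially. norm (?Y n (?Y n x) - ?Y n (Z x)) \<le> norm (?Y n x - Z x)"
        using Yle by (intro always_eventually) (simp flip: linear_simps(2)[OF Ybl])
      show "(\<lambda>n. norm (?Y n x - Z x)) \<longlonglongrightarrow> 0"
        using Zl[of x] by (intro tendsto_norm_zero) (simp add: LIM_zero)
    qed
    from tendsto_add[OF this Zl[of "Z x"]] have "(\<lambda>n. ?Y n (?Y n x)) \<longlonglongrightarrow> Z (Z x)" by simp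
    then have "(\<lambda>n. (1/2) *\<^sub>R (A x + ?Y n (?Y n x))) \<longlonglongrightarrow> (1/2) *\<^sub>R (A x + Z (Z x))"
      by (intro tendsto_intros)
    moreover have "(\<lambda>n. ?Y (Suc n) x) \<longlonglongrightarrow> Z x" using Zl by (rule LIMSEQ_Suc)
    ultimately have "Z x = (1/2) *\<^sub>R (A x + Z (Z x))" using LIMSEQ_unique by fastforce
    from arg_cong[OF this, of "scaleR 2"] show ?thesis by simp
  qed
  define C where "C = (\<lambda>x. x - Z x)"
  show ?thesis
  proof
    show "symmetric_map C" unfolding symmetric_map_def C_def using Zbl Zsym
      by (auto intro!: bounded_linear_sub bounded_linear_ident simp: inner_diff_left inner_diff_right)
    show "0 \<le> inner (C x) x" for x
    proof -
      have "inner (Z x) x \<le> norm (Z x) * norm x" by (rule norm_cauchy_schwarz)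
      also have "\<dots> \<le> norm x * norm x" using Zle by (intro mult_right_mono) auto
      finally show ?thesis by (simp add: C_def inner_diff_left dot_square_norm power2_eq_square)
    qed
    show "C (C x) = B x" for x
      using Zfix[of x] by (simp add: C_def linear_simps[OF Zbl] A_def scaleR_2 algebra_simps)
    show "C (M x) = M (C x)" if M: "bounded_linear M" and c: "\<And>y. B (M y) = M (B y)" for M x
    proof -
      have "A (M y) = M (A y)" for y by (simp add: A_def c linear_simps[OF M])
      then have "?Y n (M x) = M (?Y n x)" for n by (rule sqrt_iter_commute[OF M])
      then have "(\<lambda>n. M (?Y n x)) \<longlonglongrightarrow> Z (M x)" using Zl[of "M x"] by simp
      moreover have "(\<lambda>n. M (?Y n x)) \<longlonglongrightarrow> M (Z x)" by (rule bounded_linear.tendsto[OF M Zl])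
      ultimately have "Z (M x) = M (Z x)" by (rule LIMSEQ_unique)
      then show ?thesis by (simp add: C_def linear_simps[OF M])
    qed
  qed
qed

section \<open>Lower bounds, the bottom of a form and isolated endpoints\<close>

lemma expansive_compose:
  assumes "expansive f" "expansive g"
  shows "expansive (\<lambda>x. f (g x))"
proof -
  obtain d e where d: "d > 0" "\<And>x. d * norm x \<le> norm (f x)" and e: "e > 0" "\<And>x. e * norm x \<le> norm (g x)"
    using assms unfolding expansive_def by blast
  have "d * e * norm x \<le> norm (f (g x))" for x
    using order_trans[OF mult_left_mono[OF e(2)[of x], of d] d(2)] d(1) by (simp only: mult.assoc less_imp_le)
  then show ?thesis unfolding expansive_def using d(1) e(1) by (intro exI[of _ "d * e"]) simp
qed

lemma norm_ge_if_form_ge: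
  assumes "k * (norm y)\<^sup>2 \<le> inner z y"
  shows "k * norm y \<le> norm z"
proof (cases "y = 0")
  case False
  have "(k * norm y) * norm y \<le> norm z * norm y"
    using assms norm_cauchy_schwarz[of z y] by (simp add: power2_eq_square mult.assoc)
  then show ?thesis by (rule mult_right_le_imp_le) (use False in simp)
qed simp

text \<open>
  The infimum of the quadratic form of a symmetric operator is an approximate eigenvalue.
\<close>

lemma form_nonneg_if_shifts_expansive:
  assumes A: "symmetric_map A" and K: "0 \<le> K" "\<And>x. 0 \<le> inner (A x) x + K * (norm x)\<^sup>2"
    and ex: "\<And>m. 0 < m \<Longrightarrow> m \<le> K \<Longrightarrow> expansive (\<lambda>x. A x + m *\<^sub>R x)"
  shows "0 \<le> inner (A x) x"
proof -
  \<comment> \<open>The shifts that make the form nonnegative; being closed, this set contains its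
    infimum.\<close>
  define M where "M = {m. 0 \<le> m \<and> m \<le> K \<and> (\<forall>x. 0 \<le> inner (A x) x + m * (norm x)\<^sup>2)}"
  have KM: "K \<in> M" using K by (simp add: M_def)
  have bdd: "bdd_below M" by (intro bdd_belowI[of _ 0]) (simp add: M_def)
  have "closed M" unfolding M_def
    by (intro closed_Collect_conj closed_Collect_all closed_Collect_le continuous_intros)
  then have inf: "Inf M \<in> M" using KM bdd closed_contains_Inf by blast
  define m where "m = Inf M"
  have m: "0 \<le> m" "m \<le> K" "\<And>x. 0 \<le> inner (A x) x + m * (norm x)\<^sup>2"
    using inf by (auto simp: M_def m_def)
  have "m = 0"
  proof (rule ccontr)
    assume "m \<noteq> 0"
    then have m0: "0 < m" using m by simp
    let ?A = "\<lambda>x. A x + m *\<^sub>R x"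
    have sy: "symmetric_map ?A" using symmetric_map_affine[OF A, of 1 m] by simp
    have pos: "0 \<le> inner (?A x) x" for x using m(3)[of x] by (simp add: inner_add_left power2_norm_eq_inner)
    obtain L where L: "L > 0" "\<And>x. (norm (?A x))\<^sup>2 \<le> L * inner (?A x) x"
      using form_norm_bound[OF sy pos] by blast
    obtain e where e: "e > 0" "\<And>x. e * norm x \<le> norm (?A x)"
      using ex[OF m0 m(2)] unfolding expansive_def by blast
    \<comment> \<open>A lower bound on the norm of the shifted map becomes one on its form, through
      \<open>form_norm_bound\<close>. This leaves room to decrease the least shift by e^2 /
      L.\<close>
    have low: "e\<^sup>2 / L * (norm x)\<^sup>2 \<le> inner (A x) x + m * (norm x)\<^sup>2" for x
    proof -
      have "(e * norm x)\<^sup>2 \<le> (norm (?A x))\<^sup>2" using e by (intro power_mono) auto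
      also note L(2)
      finally show ?thesis using L(1)
        by (simp add: field_simps power_mult_distrib inner_add_left power2_norm_eq_inner)
    qed
    have k: "e\<^sup>2 / L > 0" using L(1) e(1) by simp
    have "max 0 (m - e\<^sup>2 / L) \<in> M"
    proof -
      have "0 \<le> inner (A x) x + max 0 (m - e\<^sup>2 / L) * (norm x)\<^sup>2" for x
        using low[of x] mult_right_mono[of "m - e\<^sup>2 / L" "max 0 (m - e\<^sup>2 / L)" "(norm x)\<^sup>2"]
        by (simp add: left_diff_distrib)
      then show ?thesis using m k by (simp add: M_def)
    qed
    then have "m \<le> max 0 (m - e\<^sup>2 / L)" unfolding m_def using bdd by (rule cInf_lower)
    then show False using m0 k by simp
  qed
  then show ?thesis using m(3)[of x] by simp
qed

text \<open>
  With \<open>D = 1 - S\<close> and \<open>\<epsilon> = 1 - a\<close>, the hypothesis gives \<open>D\<^sup>2 \<ge> \<epsilon> D\<close>. For the moments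
  \<open>s\<^sub>n = \<langle>D\<^sup>n x, x\<rangle>\<close> this reads \<open>s\<^sub>2 \<ge> \<epsilon> s\<^sub>1\<close> and \<open>s\<^sub>4 \<ge> \<epsilon> s\<^sub>3\<close>, and \<open>s\<^sub>2\<^sup>2 \<le> s\<^sub>1 s\<^sub>3\<close> then
  yields \<open>s\<^sub>4 \<ge> \<epsilon>\<^sup>2 s\<^sub>2\<close>, so that \<open>D\<close> is bounded below on its dense range.
\<close>

lemma expansive_at_isolated_endpoint:
  fixes S :: "'a::{real_inner,banach} \<Rightarrow> 'a"
  assumes S: "symmetric_map S" and le1: "\<And>x. inner (S x) x \<le> (norm x)\<^sup>2"
    and a: "a < 1" and ex: "\<And>t. a < t \<Longrightarrow> t < 1 \<Longrightarrow> expansive (\<lambda>x. S x - t *\<^sub>R x)"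
    and inj: "\<And>x. S x = x \<Longrightarrow> x = 0"
  shows "expansive (\<lambda>x. S x - x)"
proof -
  note s = symmetric_mapD[OF S]
  define D where "D = (\<lambda>x. x - S x)"
  have Dsym: "symmetric_map D" using symmetric_map_affine[OF S, of "-1" 1] by (simp add: D_def)
  note d = symmetric_mapD[OF Dsym]
  have Dpos: "0 \<le> inner (D x) x" for x
    using le1[of x] by (simp add: D_def inner_diff_left power2_norm_eq_inner)
  \<comment> \<open>Centre and half-length of the interval from \<open>a\<close> to 1. The
    \<open>Q\<close> below is (S - a) (S - 1) = (S - b)^2 - h^2, so adding h^2 - r^2 gives a product
    of the shifts of \<open>S\<close> by b + r and b - r.\<close>
  define b h where "b = (1 + a) / 2" and "h = (1 - a) / 2"
  define Q where "Q = (\<lambda>x. S (S x) - (1 + a) *\<^sub>R S x + a *\<^sub>R x)"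
  have Qfac: "Q x + (h\<^sup>2 - r\<^sup>2) *\<^sub>R x = S (S x - (b - r) *\<^sub>R x) - (b + r) *\<^sub>R (S x - (b - r) *\<^sub>R x)" for r x
  proof -
    have eqs: "a + (h\<^sup>2 - r\<^sup>2) = (b + r) * (b - r)" "1 + a = (b + r) + (b - r)"
      by (simp_all add: b_def h_def power2_eq_square field_simps)
    have "Q x + (h\<^sup>2 - r\<^sup>2) *\<^sub>R x = S (S x) - (1 + a) *\<^sub>R S x + (a + (h\<^sup>2 - r\<^sup>2)) *\<^sub>R x"
      unfolding Q_def scaleR_add_left[of a] by (simp only: add.assoc)
    also have "\<dots> = S (S x) - ((b + r) + (b - r)) *\<^sub>R S x + ((b + r) * (b - r)) *\<^sub>R x"
      by (simp only: eqs)
    also have "\<dots> = S (S x - (b - r) *\<^sub>R x) - (b + r) *\<^sub>R (S x - (b - r) *\<^sub>R x)"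
      by (simp only: s(4,5) scaleR_add_left scaleR_diff_right scaleR_scaleR) simp
    finally show ?thesis .
  qed
  have Qsym: "symmetric_map Q"
    unfolding symmetric_map_def
  proof (intro conjI allI)
    show "bounded_linear Q" unfolding Q_def
      by (intro bounded_linear_add bounded_linear_sub bounded_linear_const_scaleR bounded_linear_ident
          s(1) bounded_linear_compose[OF s(1) s(1)])
    show "inner (Q x) y = inner x (Q y)" for x y
      by (simp add: Q_def inner_add_left inner_add_right inner_diff_left inner_diff_right s(2))
  qed
  have Qpos: "0 \<le> inner (Q x) x" for x
  proof (rule form_nonneg_if_shifts_expansive[OF Qsym, of "h\<^sup>2"])
    show "0 \<le> inner (Q x) x + h\<^sup>2 * (norm x)\<^sup>2" for x
    proof -
      have "inner (Q x + (h\<^sup>2 - 0\<^sup>2) *\<^sub>R x) x = inner (S x - b *\<^sub>R x) (S x - b *\<^sub>R x)"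
        unfolding Qfac by (simp add: s(2) inner_diff_left inner_diff_right s(4,5))
      moreover have "inner (Q x + (h\<^sup>2 - 0\<^sup>2) *\<^sub>R x) x = inner (Q x) x + h\<^sup>2 * (norm x)\<^sup>2"
        by (simp add: inner_add_left power2_norm_eq_inner)
      ultimately show ?thesis using inner_ge_zero[of "S x - b *\<^sub>R x"] by linarith
    qed
    fix m :: real assume m: "0 < m" "m \<le> h\<^sup>2"
    \<comment> \<open>Chosen so that \<open>Q + m\<close> factors at b - r and b + r; as m > 0, both
      points lie strictly between \<open>a\<close> and 1.\<close>
    define r where "r = sqrt (h\<^sup>2 - m)"
    have r2: "h\<^sup>2 - r\<^sup>2 = m" using m by (simp add: r_def)
    have h0: "h > 0" using a by (simp add: h_def)
    have r0: "0 \<le> r" "r < h" using m h0 by (auto simp: r_def intro: real_less_lsqrt)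
    then have "a < b - r" "b - r < 1" "a < b + r" "b + r < 1" by (auto simp: b_def h_def field_simps)
    then have "expansive (\<lambda>x. S (S x - (b - r) *\<^sub>R x) - (b + r) *\<^sub>R (S x - (b - r) *\<^sub>R x))"
      using expansive_compose[of "\<lambda>x. S x - (b + r) *\<^sub>R x" "\<lambda>x. S x - (b - r) *\<^sub>R x"] ex by simp
    then show "expansive (\<lambda>x. Q x + m *\<^sub>R x)" by (simp add: Qfac flip: r2)
  qed simp
  define e where "e = 1 - a"
  have e0: "e > 0" using a by (simp add: e_def)
  \<comment> \<open>With D = 1 - S, the operator \<open>Q\<close> equals D^2 - e D.\<close>
  have 1: "e * inner (D x) x \<le> inner (D x) (D x)" for x
    using Qpos[of x] by (simp add: Q_def D_def e_def s(2) inner_diff_left inner_diff_right inner_add_left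
        algebra_simps)
  have 2: "e * norm (D x) \<le> norm (D (D x))" for x
  proof -
    define s1 s2 s3 s4 where "s1 = inner (D x) x" and "s2 = inner (D x) (D x)"
      and "s3 = inner (D (D x)) (D x)" and "s4 = inner (D (D x)) (D (D x))"
    have nn: "0 \<le> s1" "0 \<le> s2" "0 \<le> s3" using Dpos by (simp_all add: s1_def s2_def s3_def)
    have cs: "s2 * s2 \<le> s1 * s3"
      using form_Cauchy_Schwarz[OF Dsym Dpos, of x "D x"] by (simp add: s1_def s2_def s3_def power2_eq_square)
    have "s2 * (e * s2) = e * (s2 * s2)" by simp
    also have "\<dots> \<le> (e * s1) * s3" using cs e0 by (simp add: mult.assoc)
    also have "\<dots> \<le> s2 * s3" using 1[of x] nn by (intro mult_right_mono) (auto simp: s1_def s2_def)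
    finally have "s2 * (e * s2) \<le> s2 * s3" .
    then have "e * s2 \<le> s3" using nn e0 by (cases "s2 = 0") auto
    then have "e * (e * s2) \<le> e * s3" using e0 by simp
    also have "\<dots> \<le> s4" using 1[of "D x"] by (simp add: s3_def s4_def)
    finally have "(e * norm (D x))\<^sup>2 \<le> (norm (D (D x)))\<^sup>2"
      by (simp add: s2_def s4_def power_mult_distrib power2_norm_eq_inner) (simp add: power2_eq_square)
    then show ?thesis by (rule power2_le_imp_le) simp
  qed
  \<comment> \<open>Injectivity of \<open>D\<close> enters here: its range is dense, so the bound
    passes to the whole space by continuity.\<close>
  have "closed {z. e * norm z \<le> norm (D z)}"
    by (intro closed_Collect_le continuous_intros linear_continuous_on d(1))
  moreover have "range D \<subseteq> {z. e * norm z \<le> norm (D z)}" using 2 by blast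
  ultimately have "closure (range D) \<subseteq> {z. e * norm z \<le> norm (D z)}" by (rule closure_minimal[rotated])
  moreover have "closure (range D) = UNIV"
    using inj by (intro symmetric_map_dense_range[OF Dsym]) (simp add: D_def)
  ultimately have "\<And>z. e * norm z \<le> norm (S z - z)" by (auto simp: D_def norm_minus_commute)
  then show ?thesis unfolding expansive_def using e0 by blast
qed

section \<open>Comparing the shifts of \<open>T\<close> and \<open>S\<close> through a sine-cosine
  pair\<close>

lemma norm_cos_sin_le:
  assumes "symmetric_map C" "symmetric_map S" and sq: "\<And>x. S (S x) + C (C x) = x"
  shows "norm (C x) \<le> norm x" "norm (S x) \<le> norm x" "(norm x)\<^sup>2 = (norm (C x))\<^sup>2 + (norm (S x))\<^sup>2"
proof -
  show eq: "(norm x)\<^sup>2 = (norm (C x))\<^sup>2 + (norm (S x))\<^sup>2"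
    using arg_cong[OF sq[of x], of "inner x"] symmetric_mapD(2)[OF assms(1)] symmetric_mapD(2)[OF assms(2)]
    by (simp add: power2_norm_eq_inner inner_add_right)
  show "norm (C x) \<le> norm x" "norm (S x) \<le> norm x" using eq by (auto intro: power2_le_imp_le)
qed

text \<open>
  The bounds come from \<open>c (C + c) (S - \<tau> C) = (1 + c C + \<mu> S) (S - \<mu>)\<close> with \<open>c = \<surd>(1 - \<mu>\<^sup>2)\<close>, because
  \<open>C + c \<ge> c\<close> and \<open>1 + c C + \<mu> S \<ge> 1 - \<bar>\<mu>\<bar>\<close>.
\<close>

lemma shift_comparison:
  fixes C S :: "'a::real_inner \<Rightarrow> 'a"
  assumes C: "symmetric_map C" and S: "symmetric_map S" and pos: "\<And>x. 0 \<le> inner (C x) x"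
    and comm: "\<And>x. C (S x) = S (C x)" and sq: "\<And>x. S (S x) + C (C x) = x"
    and mu: "\<bar>\<mu>\<bar> < 1" and lam: "\<tau> = \<mu> / sqrt (1 - \<mu>\<^sup>2)"
  obtains k K where "k > 0" "K > 0"
    "\<And>x. k * norm (S x - \<mu> *\<^sub>R x) \<le> norm (S x - \<tau> *\<^sub>R C x)"
    "\<And>x. norm (S x - \<tau> *\<^sub>R C x) \<le> K * norm (S x - \<mu> *\<^sub>R x)"
proof -
  note s = symmetric_mapD[OF S] and c = symmetric_mapD[OF C]
  note nle = norm_cos_sin_le[OF C S sq]
  define r where "r = sqrt (1 - \<mu>\<^sup>2)"
  have mu2: "\<mu>\<^sup>2 < 1" using mu by (simp add: abs_square_less_1)
  have r: "0 < r" "r * r = 1 - \<mu> * \<mu>" "r \<le> 1" using mu2 by (simp_all add: r_def power2_eq_square)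
  have rl: "r * \<tau> = \<mu>" using r by (simp add: lam r_def[symmetric])
  define u where "u x = S x - \<mu> *\<^sub>R x" for x
  define v where "v x = S x - \<tau> *\<^sub>R C x" for x
  define L where "L y = r *\<^sub>R (C y + r *\<^sub>R y)" for y
  define R where "R y = y + r *\<^sub>R C y + \<mu> *\<^sub>R S y" for y
  have key: "L (v x) = R (u x)" for x
  proof -
    have "L (v x) = r *\<^sub>R C (S x) - (r * \<tau>) *\<^sub>R C (C x) + (r * r) *\<^sub>R S x - (r * (r * \<tau>)) *\<^sub>R C x"
      by (simp add: L_def v_def c algebra_simps)
    also have "\<dots> = r *\<^sub>R S (C x) - \<mu> *\<^sub>R C (C x) + (1 - \<mu> * \<mu>) *\<^sub>R S x - (r * \<mu>) *\<^sub>R C x"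
      by (simp only: rl r(2) comm)
    also have "C (C x) = x - S (S x)" using sq[of x] by (simp add: algebra_simps)
    also have "r *\<^sub>R S (C x) - \<mu> *\<^sub>R (x - S (S x)) + (1 - \<mu> * \<mu>) *\<^sub>R S x - (r * \<mu>) *\<^sub>R C x = R (u x)"
      by (simp add: R_def u_def c s comm algebra_simps)
    finally show ?thesis .
  qed
  have Llow: "r * r * norm y \<le> norm (L y)" for y
  proof (rule norm_ge_if_form_ge)
    show "r * r * (norm y)\<^sup>2 \<le> inner (L y) y" using r(1) pos[of y]
      by (simp add: L_def inner_add_left power2_norm_eq_inner distrib_left)
  qed
  have Lup: "norm (L y) \<le> 2 * norm y" for y
  proof -
    have "norm (L y) \<le> r * (norm (C y) + r * norm y)"
      using r(1) norm_triangle_ineq[of "C y" "r *\<^sub>R y"] by (simp add: L_def)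
    also have "\<dots> \<le> 1 * (norm y + 1 * norm y)"
      using r(1,3) nle(1)[of y] by (intro mult_mono add_mono) auto
    finally show ?thesis by simp
  qed
  have Rlow: "(1 - \<bar>\<mu>\<bar>) * norm y \<le> norm (R y)" for y
  proof (rule norm_ge_if_form_ge)
    have "\<bar>inner (S y) y\<bar> \<le> norm (S y) * norm y" by (rule Cauchy_Schwarz_ineq2)
    also have "\<dots> \<le> norm y * norm y" using nle(2) by (intro mult_right_mono) auto
    finally have "\<bar>\<mu>\<bar> * \<bar>inner (S y) y\<bar> \<le> \<bar>\<mu>\<bar> * (norm y * norm y)" by (intro mult_left_mono) auto
    then have "- (\<bar>\<mu>\<bar> * (norm y * norm y)) \<le> \<mu> * inner (S y) y"
      using abs_ge_minus_self[of "\<mu> * inner (S y) y"] by (simp add: abs_mult)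
    moreover have "0 \<le> r * inner (C y) y" using r(1) pos by simp
    ultimately show "(1 - \<bar>\<mu>\<bar>) * (norm y)\<^sup>2 \<le> inner (R y) y"
      by (simp add: R_def inner_add_left dot_square_norm power2_eq_square left_diff_distrib mult.assoc)
  qed
  have Rup: "norm (R y) \<le> 3 * norm y" for y
  proof -
    have "norm (R y) \<le> norm y + r * norm (C y) + \<bar>\<mu>\<bar> * norm (S y)"
      using r(1) norm_triangle_ineq[of "y + r *\<^sub>R C y" "\<mu> *\<^sub>R S y"] norm_triangle_ineq[of y "r *\<^sub>R C y"]
      by (simp add: R_def)
    also have "\<dots> \<le> norm y + 1 * norm y + 1 * norm y"
      using r(1,3) mu nle(1,2)[of y] by (intro mult_mono add_mono) auto
    finally show ?thesis by simp
  qed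
  show ?thesis
  proof
    \<comment> \<open>The lower bound of one outer factor over the upper bound of the other:
      \<open>Rlow\<close> with \<open>Lup\<close> here, \<open>Rup\<close> with \<open>Llow\<close>
      next.\<close>
    show "(1 - \<bar>\<mu>\<bar>) / 2 > 0" using mu by simp
    show "3 / (r * r) > 0" using r(1) by simp
    show "(1 - \<bar>\<mu>\<bar>) / 2 * norm (S x - \<mu> *\<^sub>R x) \<le> norm (S x - \<tau> *\<^sub>R C x)" for x
      using Rlow[of "u x"] Lup[of "v x"] key[of x] by (simp add: u_def v_def)
    show "norm (S x - \<tau> *\<^sub>R C x) \<le> 3 / (r * r) * norm (S x - \<mu> *\<^sub>R x)" for x
      using Llow[of "v x"] Rup[of "u x"] key[of x] r(1) by (simp add: u_def v_def field_simps)
  qed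
qed

section \<open>Maximal symmetric operators on real Hilbert spaces\<close>

text \<open>Self-adjointness over the reals. \<open>sym\<close> puts \<open>T\<close> inside its
  adjoint; \<open>maximal\<close> puts every pair satisfying the adjoint relation into the graph of
  \<open>T\<close>. Values outside \<open>D\<close> have no meaning for the operator.\<close>

locale maximal_symmetric =
  fixes D :: "'a::{real_inner,banach} set" and T :: "'a \<Rightarrow> 'a"
  assumes subspace: "subspace D"
    and add: "x \<in> D \<Longrightarrow> y \<in> D \<Longrightarrow> T (x + y) = T x + T y"
    and scale: "x \<in> D \<Longrightarrow> T (r *\<^sub>R x) = r *\<^sub>R T x"
    and sym: "x \<in> D \<Longrightarrow> y \<in> D \<Longrightarrow> inner (T x) y = inner x (T y)"
    and maximal: "(\<And>x. x \<in> D \<Longrightarrow> inner w (T x) = inner v x) \<Longrightarrow> w \<in> D \<and> T w = v"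
begin

lemma diff: "x \<in> D \<Longrightarrow> y \<in> D \<Longrightarrow> T (x - y) = T x - T y"
  using add[of x "- y"] scale[of y "-1"] subspace_neg[OF subspace, of y] by simp

lemma zero: "T 0 = 0"
  using scale[OF subspace_0[OF subspace], of 0] by simp

text \<open>The adjoint relation is preserved by limits, and \<open>maximal\<close> returns the
  limit pair to the graph.\<close>

lemma closed_graph:
  assumes "\<And>n. x n \<in> D" "x \<longlonglongrightarrow> p" "(\<lambda>n. T (x n)) \<longlonglongrightarrow> q"
  shows "p \<in> D \<and> T p = q"
proof (rule maximal)
  fix u assume u: "u \<in> D"
  have "(\<lambda>n. inner (x n) (T u)) \<longlonglongrightarrow> inner p (T u)" by (intro tendsto_intros assms)
  moreover have "(\<lambda>n. inner (T (x n)) u) \<longlonglongrightarrow> inner q u" by (intro tendsto_intros assms)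
  ultimately show "inner p (T u) = inner q u"
    using sym[OF assms(1) u] by (simp add: LIMSEQ_unique)
qed

text \<open>The graph of (1 + T^2)^(-1), kept as a relation until existence and uniqueness are
  established.\<close>

definition resolves :: "'a \<Rightarrow> 'a \<Rightarrow> bool"
  where "resolves x y \<longleftrightarrow> y \<in> D \<and> T y \<in> D \<and> y + T (T y) = x"

text \<open>
  A vector \<open>(p, q)\<close> orthogonal to the graph of \<open>T\<close> satisfies \<open>T q = - p\<close>, so the orthogonal
  projection \<open>(y, T y)\<close> of \<open>(x, 0)\<close> to the graph satisfies \<open>T (T y) = x - y\<close>.
\<close>

lemma resolves_exists: "\<exists>y. resolves x y"
proof -
  define G where "G = (\<lambda>y. (y, T y)) ` D"
  have "subspace G"
    unfolding subspace_def G_def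
    using subspace_0[OF subspace] zero
    by (auto simp: zero_prod_def image_iff add scale subspace_add[OF subspace] subspace_scale[OF subspace])
  moreover have "closed G"
    unfolding closed_sequential_limits
  proof (intro allI impI, elim conjE)
    fix g :: "nat \<Rightarrow> 'a \<times> 'a" and l assume g: "\<forall>n. g n \<in> G" and l: "g \<longlonglongrightarrow> l"
    have 1: "fst (g n) \<in> D" "snd (g n) = T (fst (g n))" for n using g[rule_format, of n] by (auto simp: G_def)
    have "fst l \<in> D \<and> T (fst l) = snd l"
      using tendsto_fst[OF l] tendsto_snd[OF l] by (intro closed_graph[of "\<lambda>n. fst (g n)"]) (simp_all add: 1)
    then show "l \<in> G" unfolding G_def by (intro image_eqI[of _ _ "fst l"]) (auto simp: prod_eq_iff)
  qed
  ultimately obtain q where q: "q \<in> G" "\<And>m. m \<in> G \<Longrightarrow> inner ((x, 0) - q) m = 0"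
    using closed_subspace_projection by blast
  then obtain y where y: "y \<in> D" "q = (y, T y)" by (auto simp: G_def)
  have "inner (T y) (T u) = inner (x - y) u" if "u \<in> D" for u
    using q(2)[of "(u, T u)"] that y(2) by (simp add: G_def)
  then have "T y \<in> D \<and> T (T y) = x - y" by (rule maximal)
  then show ?thesis using y(1) unfolding resolves_def by (intro exI[of _ y]) simp
qed

text \<open>Pairing (1 + T^2) d = 0 with \<open>d\<close> gives |d|^2 + |T d|^2 = 0.\<close>

lemma resolves_unique:
  assumes "resolves x y" "resolves x z"
  shows "y = z"
proof -
  let ?d = "y - z"
  have d: "?d \<in> D" "T ?d \<in> D" "?d + T (T ?d) = 0"
    using assms subspace_diff[OF subspace] by (auto simp: resolves_def diff) (simp add: algebra_simps)
  have "inner (?d + T (T ?d)) ?d = inner ?d ?d + inner (T ?d) (T ?d)"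
    using sym[of "T ?d" ?d] d(1,2) by (simp only: inner_add_left)
  then have "inner ?d ?d + inner (T ?d) (T ?d) = 0" using d(3) by simp
  moreover have "0 \<le> inner ?d ?d" "0 \<le> inner (T ?d) (T ?d)" by simp_all
  ultimately have "inner ?d ?d = 0" by linarith
  then show ?thesis by simp
qed

text \<open>
  Here \<open>C = \<surd>(1 + T\<^sup>2)\<^sup>-\<^sup>1\<close> and \<open>S = T C\<close>. The inclusion \<open>D \<subseteq> range C\<close> comes from the formal
  identity \<open>C\<^sup>-\<^sup>1 = C (1 + T\<^sup>2) = C + S T\<close>.
\<close>

lemma transform_exists:
  obtains C S where "symmetric_map C" "\<And>x. 0 \<le> inner (C x) x" "symmetric_map S"
    "\<And>x. resolves x (C (C x))" "\<And>x. C (S x) = S (C x)" "\<And>x. S (S x) + C (C x) = x"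
    "D = range C" "\<And>x. T (C x) = S x" "\<And>x. C x = 0 \<Longrightarrow> x = 0"
    "\<And>M x. bounded_linear M \<Longrightarrow> (\<And>y. C (C (M y)) = M (C (C y))) \<Longrightarrow> C (M x) = M (C x)"
proof -
  obtain B where B: "\<And>x. resolves x (B x)" using resolves_exists by metis
  have BI: "B x = y" if "resolves x y" for x y using resolves_unique B that by blast
  have BD: "B x \<in> D" "T (B x) \<in> D" "T (T (B x)) = x - B x" for x
    using B[of x] by (auto simp: resolves_def algebra_simps)
  have Badd: "B (x + y) = B x + B y" for x y
    by (rule BI) (simp add: resolves_def add BD subspace_add[OF subspace])
  have Bscale: "B (r *\<^sub>R x) = r *\<^sub>R B x" for r x
    by (rule BI) (simp add: resolves_def scale BD subspace_scale[OF subspace] algebra_simps)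
  \<comment> \<open>Expand x = B x + (x - B x). The cross term is the squared norm of
    \<open>T (B x)\<close>, so all three contraction bounds follow, including the one required for
    the square root.\<close>
  have pyth: "(norm x)\<^sup>2 = (norm (B x))\<^sup>2 + 2 * (norm (T (B x)))\<^sup>2 + (norm (x - B x))\<^sup>2" for x
  proof -
    have "inner (B x) (x - B x) = inner (T (B x)) (T (B x))"
      using sym[of "B x" "T (B x)"] by (simp add: BD)
    then show ?thesis
      by (simp add: power2_norm_eq_inner inner_diff_left inner_diff_right inner_commute algebra_simps)
  qed
  have contr: "norm (x - B x) \<le> norm x" and Ble: "norm (B x) \<le> norm x"
    and TBle: "norm (T (B x)) \<le> norm x" for x
  proof -
    have "0 \<le> (norm (B x))\<^sup>2" "0 \<le> (norm (T (B x)))\<^sup>2" "0 \<le> (norm (x - B x))\<^sup>2" by simp_all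
    then have "(norm (x - B x))\<^sup>2 \<le> (norm x)\<^sup>2" "(norm (B x))\<^sup>2 \<le> (norm x)\<^sup>2"
      "(norm (T (B x)))\<^sup>2 \<le> (norm x)\<^sup>2"
      using pyth[of x] by linarith+
    then show "norm (x - B x) \<le> norm x" "norm (B x) \<le> norm x" "norm (T (B x)) \<le> norm x"
      by (auto intro: power2_le_imp_le)
  qed
  \<comment> \<open>Substitute y = B y + T (T (B y)); the right side is symmetric in
    \<open>x\<close> and \<open>y\<close>, which makes \<open>B\<close> symmetric.\<close>
  have Bform: "inner (B x) y = inner (B x) (B y) + inner (T (B x)) (T (B y))" for x y
    using sym[of "B x" "T (B y)"] BD[of x] BD[of y] by (simp add: inner_diff_right)
  have Bsym: "symmetric_map B" unfolding symmetric_map_def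
  proof (intro conjI allI)
    show "bounded_linear B" using Badd Bscale Ble by (intro bounded_linear_intro[of _ 1]) auto
    show "inner (B x) y = inner x (B y)" for x y
      using Bform[of x y] Bform[of y x] by (simp add: inner_commute)
  qed
  note b = symmetric_mapD[OF Bsym]
  obtain C where C: "symmetric_map C" "\<And>x. 0 \<le> inner (C x) x" and CC: "\<And>x. C (C x) = B x"
    and Ccomm: "\<And>M x. bounded_linear M \<Longrightarrow> (\<And>y. B (M y) = M (B y)) \<Longrightarrow> C (M x) = M (C x)"
    using positive_sqrt_exists[OF Bsym contr] by blast
  note c = symmetric_mapD[OF C(1)]
  have Binj: "x = 0" if "B x = 0" for x using BD(3)[of x] that zero by simp
  have Cinj: "x = 0" if "C x = 0" for x using Binj[of x] that c(6) by (simp flip: CC)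
  have Cdense: "closure (range C) = UNIV" using symmetric_map_dense_range[OF C(1)] Cinj by blast
  \<comment> \<open>For x = C u this is \<open>Bform\<close>, as C x = B u. It makes
    \<open>T \<circ> C\<close> contractive on the dense range of \<open>C\<close>, and the closed
    graph carries it to every \<open>x\<close>.\<close>
  have norms: "C x \<in> D \<and> (norm (T (C x)))\<^sup>2 + (norm (C x))\<^sup>2 = (norm x)\<^sup>2" for x
  proof -
    have 1: "C (C u) \<in> D" "(norm (T (C (C u))))\<^sup>2 + (norm (C (C u)))\<^sup>2 = (norm (C u))\<^sup>2" for u
      using BD[of u] Bform[of u u] c(2)[of "C u" u] by (simp_all add: CC power2_norm_eq_inner)
    have TCd: "T (C (C u) - C (C v)) = T (C (C u)) - T (C (C v))" for u v by (simp add: diff 1)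
    have le: "norm (T (C (C u)) - T (C (C v))) \<le> norm (C u - C v)" for u v
    proof -
      have "(norm (T (C (C (u - v)))))\<^sup>2 \<le> (norm (C (u - v)))\<^sup>2"
        using 1(2)[of "u - v"] zero_le_power2[of "norm (C (C (u - v)))"] by linarith
      from power2_le_imp_le[OF this] show ?thesis by (simp add: c(4) TCd)
    qed
    have "x \<in> closure (range C)" using Cdense by simp
    then obtain f where f: "\<forall>n. f n \<in> range C" "f \<longlonglongrightarrow> x" unfolding closure_sequential by blast
    from f(1) have "\<forall>n. \<exists>v. f n = C v" by blast
    then obtain u where u: "\<And>n. f n = C (u n)" by metis
    have fC: "Cauchy f" using f(2) LIMSEQ_imp_Cauchy by blast
    have "Cauchy (\<lambda>n. T (C (f n)))"
    proof (rule CauchyI)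
      fix e :: real assume "e > 0"
      then obtain N where "\<forall>m\<ge>N. \<forall>n\<ge>N. norm (f m - f n) < e" using CauchyD[OF fC] by blast
      then show "\<exists>N. \<forall>m\<ge>N. \<forall>n\<ge>N. norm (T (C (f m)) - T (C (f n))) < e"
        using le_less_trans[OF le] unfolding u by blast
    qed
    then obtain q where q: "(\<lambda>n. T (C (f n))) \<longlonglongrightarrow> q" using convergent_eq_Cauchy by blast
    have Cf: "(\<lambda>n. C (f n)) \<longlonglongrightarrow> C x" using bounded_linear.tendsto[OF c(1) f(2)] .
    have cx: "C x \<in> D \<and> T (C x) = q" by (rule closed_graph[OF _ Cf q]) (simp add: u 1)
    have "(\<lambda>n. (norm (T (C (f n))))\<^sup>2 + (norm (C (f n)))\<^sup>2) \<longlonglongrightarrow> (norm q)\<^sup>2 + (norm (C x))\<^sup>2"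
      by (intro tendsto_intros q Cf)
    moreover have "(\<lambda>n. (norm (T (C (f n))))\<^sup>2 + (norm (C (f n)))\<^sup>2) = (\<lambda>n. (norm (f n))\<^sup>2)"
      by (simp add: u 1)
    moreover have "(\<lambda>n. (norm (f n))\<^sup>2) \<longlonglongrightarrow> (norm x)\<^sup>2" by (intro tendsto_intros f)
    ultimately show ?thesis using cx LIMSEQ_unique by metis
  qed
  define S where "S = (\<lambda>x. T (C x))"
  have Sle: "norm (S x) \<le> norm x" for x
  proof (rule power2_le_imp_le)
    show "(norm (S x))\<^sup>2 \<le> (norm x)\<^sup>2"
      using norms[of x] zero_le_power2[of "norm (C x)"] unfolding S_def by linarith
  qed simp
  have Sbl: "bounded_linear S"
    using norms Sle by (intro bounded_linear_intro[of _ 1]) (auto simp: S_def c add scale)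
  have BT: "B (T y) = T (B y)" if "y \<in> D" for y
  proof (rule BI)
    have "T (T (B y)) \<in> D" using BD(3)[of y] BD(1)[of y] that subspace_diff[OF subspace] by simp
    moreover have "T (B y) + T (T (T (B y))) = T y" by (simp add: BD diff that)
    ultimately show "resolves (T y) (T (B y))" by (simp add: resolves_def BD)
  qed
  have TC: "T (C x) = S x" for x by (simp add: S_def)
  have SC: "S (C x) = T (B x)" for x by (simp add: S_def CC)
  have CS: "C (S x) = S (C x)" for x
  proof -
    have bl: "bounded_linear (\<lambda>x. S (C x))" "bounded_linear (\<lambda>x. C (S x))"
      using bounded_linear_compose[OF Sbl c(1)] bounded_linear_compose[OF c(1) Sbl] by simp_all
    \<comment> \<open>S C = T B visibly commutes with \<open>B\<close>, hence with \<open>C\<close>.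
      This gives the commutation of \<open>S\<close> and \<open>C\<close> on the range of
      \<open>C\<close>, and density does the rest.\<close>
    have "C (S (C x)) = S (C (C x))" for x
      by (rule Ccomm[OF bl(1)]) (simp add: SC BT BD)
    then have "\<And>y. y \<in> range C \<Longrightarrow> C (S y) = S (C y)" by blast
    moreover have "closed {y. C (S y) = S (C y)}"
      by (intro closed_Collect_eq linear_continuous_on bl)
    ultimately have "closure (range C) \<subseteq> {y. C (S y) = S (C y)}" by (intro closure_minimal) auto
    then show ?thesis using Cdense by blast
  qed
  have Ssym: "symmetric_map S" unfolding symmetric_map_def
  proof (intro conjI allI Sbl)
    fix x y
    have "inner (S x) (C v) = inner x (S (C v))" for v
      using sym[of "C x" "C v"] norms by (simp add: TC c(2) CS)
    then have "range C \<subseteq> {y. inner (S x) y = inner x (S y)}" by blast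
    moreover have "closed {y. inner (S x) y = inner x (S y)}"
      by (intro closed_Collect_eq continuous_intros linear_continuous_on Sbl)
    ultimately have "closure (range C) \<subseteq> {y. inner (S x) y = inner x (S y)}" by (rule closure_minimal)
    then show "inner (S x) y = inner x (S y)" using Cdense by blast
  qed
  have SS: "S (S x) + C (C x) = x" for x
  proof -
    have BTB: "B (T (B z)) = T (B (B z))" for z by (simp add: BT BD)
    \<comment> \<open>The identity is checked behind the injective \<open>B\<close>, which supplies
      the vectors in the domain on which \<open>T (T _)\<close> can be evaluated.\<close>
    have "B (S (S x)) = S (S (B x))" by (simp add: CS flip: CC)
    also have "\<dots> = S (C (S (C x)))" by (simp add: CS flip: CC)
    also have "\<dots> = B (x - B x)" by (simp add: SC BTB BD b(4))
    finally have "B (S (S x) - (x - B x)) = 0" by (simp add: b(4))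
    from Binj[OF this] show ?thesis by (simp add: CC)
  qed
  have ran: "y \<in> range C" if y: "y \<in> D" for y
  proof -
    have "C (C y + S (T y)) = B y + T (B (T y))" by (simp add: c(3) CC CS SC)
    also have "\<dots> = y" using BD(3)[of y] by (simp add: BT y)
    finally show ?thesis by (metis rangeI)
  qed
  show ?thesis
  proof
    show "symmetric_map C" "symmetric_map S" "\<And>x. 0 \<le> inner (C x) x" by (fact C Ssym)+
    show "resolves x (C (C x))" for x using B by (simp add: CC)
    show "C (S x) = S (C x)" "S (S x) + C (C x) = x" for x by (fact CS SS)+
    show "D = range C" using ran norms by blast
    show "T (C x) = S x" for x by (simp add: S_def)
    show "x = 0" if "C x = 0" for x using Cinj that .
    show "C (M x) = M (C x)" if "bounded_linear M" "\<And>y. C (C (M y)) = M (C (C y))" for M x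
      using Ccomm that by (simp add: CC)
  qed
qed

end

section \<open>Self-adjoint operators on complex Hilbert spaces\<close>

instance complex_hilbert \<subseteq> banach ..

section \<open>Complex scalars on the underlying real space\<close>

lemma scaleC_of_real: "complex_of_real r *\<^sub>C x = r *\<^sub>R x"
  by (simp add: scaleR_scaleC)

lemma scaleC_zero_right: "c *\<^sub>C (0::'a::complex_hilbert) = 0"
  using scaleC_add_right[of c 0 "0::'a"] by simp

lemma scaleC_minus_right: "c *\<^sub>C (- x) = - (c *\<^sub>C x)"
  using scaleC_add_right[of c x "- x"] by (simp add: scaleC_zero_right eq_neg_iff_add_eq_0 add.commute)

lemma scaleC_diff_right: "c *\<^sub>C (x - y) = c *\<^sub>C x - c *\<^sub>C y"
  using scaleC_add_right[of c x "- y"] by (simp add: scaleC_minus_right)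

lemma scaleC_minus_left: "(- c) *\<^sub>C x = - (c *\<^sub>C x)"
  using scaleC_add_left[of c "- c" x] scaleC_of_real[of 0 x] by (simp add: eq_neg_iff_add_eq_0 add.commute)

lemma scaleC_expand: "z *\<^sub>C x = Re z *\<^sub>R x + Im z *\<^sub>R (\<i> *\<^sub>C x)"
proof -
  have "z *\<^sub>C x = (complex_of_real (Re z) + complex_of_real (Im z) * \<i>) *\<^sub>C x"
    using complex_eq[of z] by (simp add: mult.commute)
  then show ?thesis by (simp add: scaleC_add_left scaleC_of_real flip: scaleC_scaleC)
qed

lemma scaleC_scaleR: "c *\<^sub>C (r *\<^sub>R x) = r *\<^sub>R (c *\<^sub>C x)"
  by (simp add: scaleR_scaleC scaleC_scaleC mult.commute)

lemma cinner_scaleC_left: "cinner (c *\<^sub>C x) y = cnj c * cinner x y"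
  by (metis cinner_commute cinner_scaleC_right complex_cnj_mult)

lemma inner_scaleC_left: "inner (c *\<^sub>C x) y = inner x (cnj c *\<^sub>C y)"
  by (simp add: inner_cinner cinner_scaleC_left cinner_scaleC_right)

text \<open>The real inner product determines the complex one; this is what allows the reduction to
  real Hilbert spaces.\<close>

lemma cinner_eq_Complex: "cinner x y = Complex (inner x y) (- inner x (\<i> *\<^sub>C y))"
  by (simp add: inner_cinner cinner_scaleC_right complex_eq_iff)

lemma norm_scaleC: "norm (c *\<^sub>C x) = cmod c * norm x"
proof (rule power2_eq_imp_eq)
  have "(norm (c *\<^sub>C x))\<^sup>2 = Re (c * cnj c * cinner x x)"
    by (simp add: power2_norm_eq_inner inner_cinner cinner_scaleC_left cinner_scaleC_right mult_ac)
  also have "\<dots> = (cmod c)\<^sup>2 * inner x x" by (simp add: complex_norm_square[symmetric] inner_cinner)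
  finally show "(norm (c *\<^sub>C x))\<^sup>2 = (cmod c * norm x)\<^sup>2"
    by (simp add: power_mult_distrib power2_norm_eq_inner)
qed simp_all

lemma bounded_linear_scaleC: "bounded_linear (\<lambda>x. c *\<^sub>C x)"
  by (intro bounded_linear_intro[of _ "cmod c"])
    (simp_all add: scaleC_add_right scaleC_scaleR norm_scaleC mult.commute)

section \<open>Self-adjointness in terms of the real inner product\<close>

lemma linear_operatorD:
  assumes "linear_operator T"
  shows "T 0 = Some 0" "T x = Some u \<Longrightarrow> T y = Some v \<Longrightarrow> T (x + y) = Some (u + v)"
    "T x = Some u \<Longrightarrow> T (c *\<^sub>C x) = Some (c *\<^sub>C u)" "T x = Some u \<Longrightarrow> T (r *\<^sub>R x) = Some (r *\<^sub>R u)"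
    "T x = Some u \<Longrightarrow> T y = Some v \<Longrightarrow> T (x - y) = Some (u - v)"
proof -
  show 1: "T (x + y) = Some (u + v)" if "T x = Some u" "T y = Some v" for x y u v
    using assms that by (simp add: linear_operator_def)
  show 2: "T (c *\<^sub>C x) = Some (c *\<^sub>C u)" if "T x = Some u" for c x u
    using assms that by (simp add: linear_operator_def)
  show 3: "T (r *\<^sub>R x) = Some (r *\<^sub>R u)" if "T x = Some u" for r x u
    using 2 that by (simp add: scaleR_scaleC)
  show "T (x - y) = Some (u - v)" if "T x = Some u" "T y = Some v"
    using 1[OF that(1) 3[OF that(2), of "-1"]] by simp
  show "T 0 = Some 0" using assms by (simp add: linear_operator_def)
qed

lemma dense_inner_eqI:
  fixes z z' :: "'a::real_inner"
  assumes "closure X = UNIV" "\<And>x. x \<in> X \<Longrightarrow> inner z x = inner z' x"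
  shows "z = z'"
proof -
  have "closed {x. inner z x = inner z' x}" by (intro closed_Collect_eq continuous_intros)
  then have "closure X \<subseteq> {x. inner z x = inner z' x}" using assms(2) by (intro closure_minimal) auto
  then have "inner z (z - z') = inner z' (z - z')" using assms(1) by blast
  then have "inner (z - z') (z - z') = 0" by (simp add: inner_diff_left)
  then show ?thesis by simp
qed

lemma operator_eqI:
  assumes "\<And>x u. T x = Some u \<longleftrightarrow> R x = Some u"
  shows "T = R"
proof
  fix x show "T x = R x"
  proof (cases "T x")
    case None
    then have "R x \<noteq> Some u" for u using assms[of x u] by simp
    then show ?thesis using None option.exhaust[of "R x"] by metis
  next
    case (Some u)
    then show ?thesis using assms[of x u] by simp
  qed
qed

text \<open>The real condition at \<i> x supplies the imaginary part of the complex condition at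
  x.\<close>

lemma adjoint_condition_iff:
  assumes "linear_operator T"
  shows "(\<forall>x\<in>dom T. cinner y (the (T x)) = cinner z x) \<longleftrightarrow> (\<forall>x\<in>dom T. inner y (the (T x)) = inner z x)"
proof
  assume r: "\<forall>x\<in>dom T. inner y (the (T x)) = inner z x"
  show "\<forall>x\<in>dom T. cinner y (the (T x)) = cinner z x"
  proof
    fix x assume "x \<in> dom T"
    then obtain u where u: "T x = Some u" by blast
    have iu: "T (\<i> *\<^sub>C x) = Some (\<i> *\<^sub>C u)" using linear_operatorD(3)[OF assms u] .
    have "inner y u = inner z x" "inner y (\<i> *\<^sub>C u) = inner z (\<i> *\<^sub>C x)"
      using r[rule_format, of x] r[rule_format, of "\<i> *\<^sub>C x"] u iu by auto
    then show "cinner y (the (T x)) = cinner z x" using u by (simp add: cinner_eq_Complex)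
  qed
qed (simp add: inner_cinner)

text \<open>Density makes the vector chosen in \<open>adjoint_op\<close> unique, so the description
  operator can be traded for a relation on graphs.\<close>

lemma self_adjoint_iff:
  "self_adjoint T \<longleftrightarrow> linear_operator T \<and> closure (dom T) = UNIV \<and>
    (\<forall>y z. T y = Some z \<longleftrightarrow> (\<forall>x\<in>dom T. inner y (the (T x)) = inner z x))"
proof (cases "linear_operator T \<and> closure (dom T) = UNIV")
  case True
  then have lin: "linear_operator T" and dense: "closure (dom T) = UNIV" by auto
  define P where "P = (\<lambda>y z. \<forall>x\<in>dom T. inner y (the (T x)) = inner z x)"
  have uniq: "z = z'" if "P y z" "P y z'" for y z z'
    using that by (intro dense_inner_eqI[OF dense]) (simp add: P_def)
  have the: "(THE z. P y z) = z" if "P y z" for y z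
    using that uniq by (intro the_equality)
  have "adjoint_op T y = (if \<exists>z. P y z then Some (THE z. P y z) else None)" for y
    by (simp only: adjoint_op_def adjoint_condition_iff[OF lin] P_def)
  then have adj: "adjoint_op T y = Some z \<longleftrightarrow> P y z" for y z
    using the by auto
  have "adjoint_op T = T \<longleftrightarrow> (\<forall>y z. T y = Some z \<longleftrightarrow> adjoint_op T y = Some z)"
    using operator_eqI[of "adjoint_op T" T] by auto
  then have "adjoint_op T = T \<longleftrightarrow> (\<forall>y z. T y = Some z \<longleftrightarrow> (\<forall>x\<in>dom T. inner y (the (T x)) = inner z x))"
    unfolding adj P_def .
  then show ?thesis unfolding self_adjoint_def by (intro conj_cong refl)
next
  case False
  then have "\<not> self_adjoint T"
    by (rule contrapos_nn) (simp only: self_adjoint_def simp_thms)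
  with False show ?thesis by iprover
qed

text \<open>The two directions of the equivalence in \<open>self_adjoint_iff\<close> are symmetry
  and maximality.\<close>

lemma self_adjoint_maximal_symmetric:
  assumes "self_adjoint T"
  shows "maximal_symmetric (dom T) (\<lambda>x. the (T x))"
proof -
  note sa = assms[unfolded self_adjoint_iff]
  have lin: "linear_operator T" using sa by (rule conjunct1)
  have ad: "T y = Some z \<longleftrightarrow> (\<forall>x\<in>dom T. inner y (the (T x)) = inner z x)" for y z
    by (rule sa[THEN conjunct2, THEN conjunct2, THEN spec, THEN spec])
  note l = linear_operatorD[OF lin]
  show ?thesis
  proof
    show "subspace (dom T)" unfolding subspace_def using l by blast
    show "the (T (x + y)) = the (T x) + the (T y)" if "x \<in> dom T" "y \<in> dom T" for x y
      using that l(2) by force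
    show "the (T (r *\<^sub>R x)) = r *\<^sub>R the (T x)" if "x \<in> dom T" for x r
      using that l(4) by force
    show "inner (the (T x)) y = inner x (the (T y))" if "x \<in> dom T" "y \<in> dom T" for x y
      using that ad[of x] by (metis domD option.sel)
    show "w \<in> dom T \<and> the (T w) = v" if "\<And>x. x \<in> dom T \<Longrightarrow> inner w (the (T x)) = inner v x" for w v
      using that ad[of w v] by auto
  qed
qed

section \<open>Inverses, positivity and the operator square root\<close>

lemma op_inv_eq_Some_iff:
  assumes inj: "\<And>x x' y. T x = Some y \<Longrightarrow> T x' = Some y \<Longrightarrow> x = x'"
  shows "op_inv T y = Some x \<longleftrightarrow> T x = Some y"
proof
  assume "op_inv T y = Some x"
  then have 1: "\<exists>!x. T x = Some y" and 2: "(THE x. T x = Some y) = x"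
    by (simp_all add: op_inv_def split: if_splits)
  from theI'[OF 1] show "T x = Some y" unfolding 2 .
next
  assume x: "T x = Some y"
  then have "(THE x. T x = Some y) = x" using inj by (intro the_equality) blast+
  moreover have "\<exists>!x. T x = Some y" using x inj by (intro ex1I[of _ x]) blast+
  ultimately show "op_inv T y = Some x" by (simp add: op_inv_def)
qed

lemma op_inv_total_eq_Some_iff:
  assumes "inj C"
  shows "op_inv (Some \<circ> C) y = Some x \<longleftrightarrow> C x = y"
  using assms by (subst op_inv_eq_Some_iff) (auto dest: injD)

lemma op_inv_op_inv_total:
  assumes "inj C"
  shows "op_inv (op_inv (Some \<circ> C)) = Some \<circ> C"
proof
  fix x
  have "op_inv (op_inv (Some \<circ> C)) x = Some (C x)"
    by (subst op_inv_eq_Some_iff) (auto simp: op_inv_total_eq_Some_iff[OF assms])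
  then show "op_inv (op_inv (Some \<circ> C)) x = (Some \<circ> C) x" by simp
qed

lemma symmetric_map_inj:
  assumes "symmetric_map C" "\<And>x. C x = 0 \<Longrightarrow> x = 0"
  shows "inj C"
  using assms by (intro injI) (metis eq_iff_diff_eq_0 symmetric_mapD(4))

lemma self_adjoint_total:
  assumes S: "symmetric_map S" and cl: "\<And>c x. S (c *\<^sub>C x) = c *\<^sub>C S x"
  shows "self_adjoint (Some \<circ> S)"
proof -
  note s = symmetric_mapD[OF S]
  have dom: "dom (Some \<circ> S) = UNIV" by auto
  have "S y = z \<longleftrightarrow> (\<forall>x. inner y (S x) = inner z x)" for y z
  proof
    assume "\<forall>x. inner y (S x) = inner z x"
    then have "inner (S y) x = inner z x" for x by (simp add: s(2))
    then show "S y = z" using dense_inner_eqI[of UNIV "S y" z] by simp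
  qed (auto simp: s(2))
  moreover have "linear_operator (Some \<circ> S)" by (auto simp: linear_operator_def s(3,6) cl)
  ultimately show ?thesis unfolding self_adjoint_iff dom by simp
qed

text \<open>At x = C u the adjoint relation reads <y, u> = <z, C u> = <C z, u> for all
  \<open>u\<close>, that is, y = C z.\<close>

lemma self_adjoint_op_inv_total:
  assumes C: "symmetric_map C" and cl: "\<And>c x. C (c *\<^sub>C x) = c *\<^sub>C C x" and inj0: "\<And>x. C x = 0 \<Longrightarrow> x = 0"
  shows "self_adjoint (op_inv (Some \<circ> C))"
proof -
  note c = symmetric_mapD[OF C]
  have injC: "inj C" using symmetric_map_inj[OF C] inj0 by blast
  note inv = op_inv_total_eq_Some_iff[OF injC]
  let ?R = "op_inv (Some \<circ> C)"
  have dom: "dom ?R = range C" by (auto simp: dom_def inv)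
  have the: "the (?R (C u)) = u" for u using inv[of "C u" u] by simp
  have "linear_operator ?R" by (auto simp: linear_operator_def inv c cl)
  moreover have "closure (range C) = UNIV" by (rule symmetric_map_dense_range[OF C inj0])
  moreover have "C z = y \<longleftrightarrow> (\<forall>x\<in>range C. inner y (the (?R x)) = inner z x)" for y z
  proof
    assume "\<forall>x\<in>range C. inner y (the (?R x)) = inner z x"
    then have "inner y u = inner (C z) u" for u by (simp add: the c(2))
    then show "C z = y" using dense_inner_eqI[of UNIV y "C z"] by simp
  qed (auto simp: the c(2))
  ultimately show ?thesis unfolding self_adjoint_iff dom inv by (intro conjI allI)
qed

text \<open>The form of \<open>T\<close> is real: moving \<i> across the inner product changes the
  sign, moving \<open>T\<close> does not.\<close>

lemma self_adjoint_inner_imaginary: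
  assumes T: "self_adjoint T" and x: "T x = Some u"
  shows "inner u (\<i> *\<^sub>C x) = 0"
proof -
  interpret maximal_symmetric "dom T" "\<lambda>x. the (T x)" using self_adjoint_maximal_symmetric[OF T] .
  have ix: "T (\<i> *\<^sub>C x) = Some (\<i> *\<^sub>C u)" using T x by (simp add: self_adjoint_def linear_operatorD(3))
  have "inner u (\<i> *\<^sub>C x) = inner x (\<i> *\<^sub>C u)" using sym[of x "\<i> *\<^sub>C x"] x ix by auto
  also have "\<dots> = - inner (\<i> *\<^sub>C x) u" by (simp add: inner_scaleC_left scaleC_minus_left)
  finally show ?thesis by (simp add: inner_commute)
qed

lemma positive_op_iff:
  assumes "self_adjoint R"
  shows "positive_op R \<longleftrightarrow> (\<forall>x u. R x = Some u \<longrightarrow> 0 \<le> inner u x)"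
proof -
  have "cinner x u \<in> \<real>\<^sub>\<ge>\<^sub>0 \<longleftrightarrow> 0 \<le> inner u x" if "R x = Some u" for x u
  proof -
    have "inner x (\<i> *\<^sub>C u) = - inner (\<i> *\<^sub>C x) u" by (simp add: inner_scaleC_left scaleC_minus_left)
    then have "inner x (\<i> *\<^sub>C u) = 0"
      using self_adjoint_inner_imaginary[OF assms that] by (simp add: inner_commute)
    then show ?thesis by (simp add: cinner_eq_Complex complex_nonneg_Reals_iff inner_commute)
  qed
  note iff = this
  show ?thesis
  proof
    assume p: "positive_op R"
    show "\<forall>x u. R x = Some u \<longrightarrow> 0 \<le> inner u x"
    proof (intro allI impI)
      fix x u assume x: "R x = Some u"
      then have "x \<in> dom R" by blast
      then have "cinner x u \<in> \<real>\<^sub>\<ge>\<^sub>0" using p x unfolding positive_op_def by (metis option.sel)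
      then show "0 \<le> inner u x" using iff[OF x] by simp
    qed
  qed (auto simp: positive_op_def iff)
qed

text \<open>
  A positive self-adjoint square root \<open>R\<close> of \<open>C\<^sup>-\<^sup>2\<close> has an everywhere defined inverse, which is a
  positive square root of \<open>C\<^sup>2\<close>; the uniqueness of the latter identifies \<open>R\<close> with \<open>C\<^sup>-\<^sup>1\<close>.
\<close>

lemma op_sqrt_eq_op_inv:
  assumes C: "symmetric_map C" and cl: "\<And>c x. C (c *\<^sub>C x) = c *\<^sub>C C x" and inj0: "\<And>x. C x = 0 \<Longrightarrow> x = 0"
    and pos: "\<And>x. 0 \<le> inner (C x) x"
    and comm: "\<And>M x. bounded_linear M \<Longrightarrow> (\<And>y. C (C (M y)) = M (C (C y))) \<Longrightarrow> C (M x) = M (C x)"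
    and A: "\<And>x y. A y = Some x \<longleftrightarrow> C (C x) = y"
  shows "op_sqrt A = op_inv (Some \<circ> C)"
  unfolding op_sqrt_def
proof (rule the_equality)
  note c = symmetric_mapD[OF C]
  have injC: "inj C" using symmetric_map_inj[OF C] inj0 by blast
  note inv = op_inv_total_eq_Some_iff[OF injC]
  let ?R = "op_inv (Some \<circ> C)"
  have sa: "self_adjoint ?R" using self_adjoint_op_inv_total[OF C cl] inj0 by blast
  moreover have "positive_op ?R" unfolding positive_op_iff[OF sa] inv
    using pos by (auto simp: inner_commute)
  moreover have "?R \<circ>\<^sub>m ?R = A"
    by (rule operator_eqI) (auto simp: map_comp_Some_iff inv A)
  ultimately show "self_adjoint ?R \<and> positive_op ?R \<and> ?R \<circ>\<^sub>m ?R = A" by blast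
  fix R assume "self_adjoint R \<and> positive_op R \<and> R \<circ>\<^sub>m R = A"
  then have R: "self_adjoint R" and Rp: "positive_op R" and RR: "R \<circ>\<^sub>m R = A" by auto
  interpret R: maximal_symmetric "dom R" "\<lambda>x. the (R x)" using self_adjoint_maximal_symmetric[OF R] .
  have l: "linear_operator R" using R by (simp add: self_adjoint_def)
  note l = linear_operatorD[OF l]
  \<comment> \<open>\<open>A\<close> maps \<open>C (C x)\<close> to \<open>x\<close> in two
    applications of \<open>R\<close>, so the intermediate value is a preimage of \<open>x\<close>
    under \<open>R\<close>; thus \<open>R\<close> is onto and \<open>E\<close> is its
    inverse.\<close>
  have "\<exists>v. R (C (C x)) = Some v \<and> R v = Some x" for x
    using A[of "C (C x)" x] by (auto simp flip: RR simp: map_comp_Some_iff)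
  then obtain E where E: "\<And>x. R (C (C x)) = Some (E x)" "\<And>x. R (E x) = Some x" by metis
  have Rinj: "u = u'" if "R u = Some w" "R u' = Some w" for u u' w
  proof -
    have "R (u - u') = Some 0" using l(5)[OF that] by simp
    then have "A (u - u') = Some 0" using l(1) by (simp flip: RR add: map_comp_Some_iff)
    then show ?thesis by (simp add: A c(6))
  qed
  have RE: "R u = Some x \<longleftrightarrow> u = E x" for u x using Rinj E(2) by blast
  have EE: "E (E x) = C (C x)" for x using E(1)[of x] by (simp add: RE)
  have Esym: "inner (E x) y = inner x (E y)" for x y
    using R.sym[of "E x" "E y"] E(2)[of x] E(2)[of y] by (simp add: domI)
  have Epos: "0 \<le> inner (E x) x" for x
  proof -
    have "0 \<le> inner x (E x)" using Rp E(2)[of x] unfolding positive_op_iff[OF R] by blast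
    then show ?thesis by (simp add: inner_commute)
  qed
  have "E (x + y) = E x + E y" for x y using l(2)[OF E(2) E(2), of x y] by (simp add: RE)
  moreover have "E (r *\<^sub>R x) = r *\<^sub>R E x" for r x using l(4)[OF E(2), of r x] by (simp add: RE)
  \<comment> \<open>E^2 = C^2 and symmetry give equal norms, so \<open>E\<close> inherits
    boundedness from \<open>C\<close>.\<close>
  moreover have "norm (E x) = norm (C x)" for x
    by (simp add: norm_eq_sqrt_inner Esym EE c(2))
  ultimately have "bounded_linear E"
    using bounded_linear.bounded[OF c(1)] by (auto intro!: bounded_linear_intro)
  then have Es: "symmetric_map E" using Esym by (simp add: symmetric_map_def)
  have "C x = E x" for x
  proof (rule positive_sqrt_unique[OF C pos Es Epos])
    show "C (C x) = E (E x)" for x by (simp add: EE)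
    \<comment> \<open>\<open>E\<close> commutes with its own square, which is C^2, hence with
      \<open>C\<close>.\<close>
    show "C (E x) = E (C x)" for x
      by (rule comm[OF \<open>bounded_linear E\<close>]) (simp flip: EE)
  qed
  then have "R y = Some x \<longleftrightarrow> ?R y = Some x" for x y by (auto simp: RE inv)
  then show "R = ?R" by (rule operator_eqI)
qed

text \<open>The last conclusion parametrises the graph of \<open>T\<close> by the whole space, so
  that statements about \<open>T\<close> become statements about two bounded maps.\<close>

lemma bounded_transform_structure:
  assumes T: "self_adjoint T"
  obtains C S where "bounded_transform T = Some \<circ> S" "self_adjoint (Some \<circ> S)"
    "symmetric_map C" "\<And>x. 0 \<le> inner (C x) x" "symmetric_map S"
    "\<And>x. C (S x) = S (C x)" "\<And>x. S (S x) + C (C x) = x" "\<And>x. C x = 0 \<Longrightarrow> x = 0"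
    "\<And>y v. T y = Some v \<longleftrightarrow> (\<exists>x. y = C x \<and> v = S x)"
proof -
  interpret maximal_symmetric "dom T" "\<lambda>x. the (T x)" using self_adjoint_maximal_symmetric[OF T] .
  obtain C S where C: "symmetric_map C" "\<And>x. 0 \<le> inner (C x) x" and S: "symmetric_map S"
    and res: "\<And>x. resolves x (C (C x))" and CS: "\<And>x. C (S x) = S (C x)" and sq: "\<And>x. S (S x) + C (C x) = x"
    and dom: "dom T = range C" and TC: "\<And>x. the (T (C x)) = S x" and inj0: "\<And>x. C x = 0 \<Longrightarrow> x = 0"
    and comm: "\<And>M x. bounded_linear M \<Longrightarrow> (\<And>y. C (C (M y)) = M (C (C y))) \<Longrightarrow> C (M x) = M (C x)"
    by (rule transform_exists) blast
  have l: "linear_operator T" using T by (simp add: self_adjoint_def)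
  note l = linear_operatorD[OF l]
  have T_iff: "T y = Some v \<longleftrightarrow> (\<exists>x. y = C x \<and> v = S x)" for y v
  proof
    assume y: "T y = Some v"
    then obtain x where "y = C x" using dom by blast
    then show "\<exists>x. y = C x \<and> v = S x" using TC[of x] y by auto
  next
    assume "\<exists>x. y = C x \<and> v = S x"
    then obtain x where x: "y = C x" "v = S x" by blast
    then have "y \<in> dom T" using dom by blast
    then show "T y = Some v" using TC[of x] x by auto
  qed
  have plus: "op_plus Some (T \<circ>\<^sub>m T) y = Some x \<longleftrightarrow> C (C x) = y" for x y
  proof -
    have "op_plus Some (T \<circ>\<^sub>m T) y = Some x \<longleftrightarrow> resolves x y"
      by (auto simp: op_plus_def resolves_def map_comp_Some_iff map_comp_def split: option.splits)
    then show ?thesis using res[of x] resolves_unique by blast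
  qed
  \<comment> \<open>(1 + T^2)^(-1) commutes with complex scalars, hence so does its root.\<close>
  have Ccl: "C (c *\<^sub>C x) = c *\<^sub>C C x" for c x
  proof (rule comm[OF bounded_linear_scaleC])
    fix y
    obtain u v where u: "T (C (C y)) = Some u" "T u = Some v" "C (C y) + v = y"
      using res[of y] by (auto simp: resolves_def)
    have "resolves (c *\<^sub>C y) (c *\<^sub>C C (C y))"
      using l(3)[OF u(1), of c] l(3)[OF u(2), of c] u(3)
      by (auto simp: resolves_def scaleC_add_right[symmetric])
    then show "C (C (c *\<^sub>C y)) = c *\<^sub>C C (C y)" using res resolves_unique by blast
  qed
  have Scl: "S (c *\<^sub>C x) = c *\<^sub>C S x" for c x
  proof -
    have "T (C x) = Some (S x)" using T_iff by blast
    from l(3)[OF this, of c] show ?thesis using TC[of "c *\<^sub>C x"] by (simp add: Ccl)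
  qed
  have inv: "op_inv (op_sqrt (op_plus Some (T \<circ>\<^sub>m T))) = Some \<circ> C"
  proof -
    have "op_sqrt (op_plus Some (T \<circ>\<^sub>m T)) = op_inv (Some \<circ> C)"
      by (rule op_sqrt_eq_op_inv[OF C(1) Ccl _ C(2) _ plus]) (fact inj0, fact comm)
    moreover have "inj C" using symmetric_map_inj[OF C(1)] inj0 by blast
    ultimately show ?thesis by (simp add: op_inv_op_inv_total)
  qed
  have "bounded_transform T = Some \<circ> S"
  proof
    fix x
    have "T (C x) = Some (S x)" using T_iff by blast
    then show "bounded_transform T x = (Some \<circ> S) x"
      unfolding bounded_transform_def inv by (simp add: map_comp_def)
  qed
  then show ?thesis
    by (rule that) (fact self_adjoint_total[OF S Scl] C S CS sq inj0 T_iff)+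
qed

section \<open>Spectra\<close>

text \<open>Both \<open>u\<close> and \<open>x\<close> are orthogonal to \<i> x in the real inner
  product. Hence nonreal shifts are bounded below, and \<open>z\<close> and \<open>cnj z\<close>
  give equal norms.\<close>

lemma self_adjoint_norm_shift:
  assumes T: "self_adjoint T" and x: "T x = Some u"
  shows "(norm (u - z *\<^sub>C x))\<^sup>2 = (norm (u - Re z *\<^sub>R x))\<^sup>2 + (Im z)\<^sup>2 * (norm x)\<^sup>2"
proof -
  let ?i = "\<i> *\<^sub>C x"
  have 1: "inner u ?i = 0" by (rule self_adjoint_inner_imaginary[OF assms])
  have "inner x ?i = - inner ?i x" by (simp add: inner_scaleC_left scaleC_minus_left)
  then have 2: "inner x ?i = 0" by (simp add: inner_commute)
  have 3: "inner ?i ?i = inner x x" using norm_scaleC[of \<i> x] by (simp add: norm_eq_sqrt_inner)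
  have "u - z *\<^sub>C x = (u - Re z *\<^sub>R x) - Im z *\<^sub>R ?i" by (simp add: scaleC_expand[of z x] algebra_simps)
  moreover have "inner (u - Re z *\<^sub>R x) (Im z *\<^sub>R ?i) = 0" using 1 2 by (simp add: inner_diff_left)
  moreover have "(norm (v - w))\<^sup>2 = (norm v)\<^sup>2 + (norm w)\<^sup>2" if "inner v w = 0" for v w :: 'a
    using that by (simp add: power2_norm_eq_inner inner_diff_left inner_diff_right inner_commute)
  ultimately have "(norm (u - z *\<^sub>C x))\<^sup>2 = (norm (u - Re z *\<^sub>R x))\<^sup>2 + (norm (Im z *\<^sub>R ?i))\<^sup>2"
    by metis
  then show ?thesis by (simp add: power_mult_distrib norm_scaleC)
qed

lemma op_plus_scalar: "op_plus T (scalar_op (- z)) x = map_option (\<lambda>u. u - z *\<^sub>C x) (T x)"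
  by (simp add: op_plus_def scalar_op_def scaleC_minus_left split: option.splits)

text \<open>A lower bound gives injectivity and, by the closed graph, a closed range. The range is
  also dense: a vector orthogonal to it would satisfy T w = \<open>cnj z\<close> w, and the bound
  holds for \<open>cnj z\<close> as well.\<close>

lemma resolvent_set_iff:
  assumes T: "self_adjoint T"
  shows "z \<in> resolvent_set T \<longleftrightarrow> (\<exists>e>0. \<forall>x u. T x = Some u \<longrightarrow> e * norm x \<le> norm (u - z *\<^sub>C x))"
proof -
  interpret maximal_symmetric "dom T" "\<lambda>x. the (T x)" using self_adjoint_maximal_symmetric[OF T] .
  have l: "linear_operator T" using T by (simp add: self_adjoint_def)
  note l = linear_operatorD[OF l]
  have "z \<in> resolvent_set T \<longleftrightarrow> (\<exists>B. bounded_linear B \<and> (\<forall>y. \<exists>u. T (B y) = Some u \<and> u - z *\<^sub>C B y = y) \<and>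
      (\<forall>x u. T x = Some u \<longrightarrow> B (u - z *\<^sub>C x) = x))"
  proof -
    have 1: "op_plus T (scalar_op (- z)) \<circ>\<^sub>m (Some \<circ> B) = Some \<longleftrightarrow>
        (\<forall>y. \<exists>u. T (B y) = Some u \<and> u - z *\<^sub>C B y = y)" for B
      by (simp add: fun_eq_iff map_comp_def op_plus_scalar)
    have 2: "(Some \<circ> B) \<circ>\<^sub>m op_plus T (scalar_op (- z)) = Some |` dom T \<longleftrightarrow>
        (\<forall>x u. T x = Some u \<longrightarrow> B (u - z *\<^sub>C x) = x)" for B
    proof -
      have "((Some \<circ> B) \<circ>\<^sub>m op_plus T (scalar_op (- z))) x = (Some |` dom T) x \<longleftrightarrow>
          (\<forall>u. T x = Some u \<longrightarrow> B (u - z *\<^sub>C x) = x)" for x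
        by (cases "T x") (auto simp: map_comp_def op_plus_scalar restrict_map_def)
      then show ?thesis by (simp add: fun_eq_iff)
    qed
    show ?thesis unfolding resolvent_set_def by (simp add: 1 2)
  qed
  also have "\<dots> \<longleftrightarrow> (\<exists>e>0. \<forall>x u. T x = Some u \<longrightarrow> e * norm x \<le> norm (u - z *\<^sub>C x))" (is "?L \<longleftrightarrow> ?R")
  proof
    assume ?L
    then obtain B where B: "bounded_linear B" "\<And>x u. T x = Some u \<Longrightarrow> B (u - z *\<^sub>C x) = x" by blast
    obtain K where K: "K > 0" "\<And>y. norm (B y) \<le> norm y * K" using bounded_linear.pos_bounded[OF B(1)] by blast
    have "1 / K * norm x \<le> norm (u - z *\<^sub>C x)" if "T x = Some u" for x u
      using K(2)[of "u - z *\<^sub>C x"] B(2)[OF that] K(1) by (simp add: field_simps)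
    then show ?R using K(1) by (intro exI[of _ "1 / K"]) simp
  next
    assume ?R
    then obtain e where e: "e > 0" "\<And>x u. T x = Some u \<Longrightarrow> e * norm x \<le> norm (u - z *\<^sub>C x)" by blast
    define M where "M = {u - z *\<^sub>C x | x u. T x = Some u}"
    have d: "norm (x - x') \<le> (1 / e) * norm (u - z *\<^sub>C x - (u' - z *\<^sub>C x'))"
      if "T x = Some u" "T x' = Some u'" for x x' u u'
    proof -
      have "e * norm (x - x') \<le> norm ((u - u') - z *\<^sub>C (x - x'))" by (rule e(2)[OF l(5)[OF that]])
      also have "(u - u') - z *\<^sub>C (x - x') = u - z *\<^sub>C x - (u' - z *\<^sub>C x')" by (simp add: scaleC_diff_right)
      finally show ?thesis using e(1) by (simp add: field_simps)
    qed
    have subM: "subspace M"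
      unfolding subspace_def
    proof (intro conjI ballI allI)
      show "0 \<in> M" unfolding M_def using l(1) scaleC_zero_right[of z]
        by (intro CollectI exI[of _ 0]) simp
    next
      fix a b assume "a \<in> M" "b \<in> M"
      then obtain x u y v where "T x = Some u" "a = u - z *\<^sub>C x" "T y = Some v" "b = v - z *\<^sub>C y"
        by (auto simp: M_def)
      then have "T (x + y) = Some (u + v)" "a + b = (u + v) - z *\<^sub>C (x + y)"
        using l(2) by (auto simp: scaleC_add_right)
      then show "a + b \<in> M" unfolding M_def by blast
    next
      fix r :: real and a assume "a \<in> M"
      then obtain x u where "T x = Some u" "a = u - z *\<^sub>C x" by (auto simp: M_def)
      then have "T (r *\<^sub>R x) = Some (r *\<^sub>R u)" "r *\<^sub>R a = r *\<^sub>R u - z *\<^sub>C (r *\<^sub>R x)"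
        using l(4) by (auto simp: scaleC_scaleR algebra_simps)
      then show "r *\<^sub>R a \<in> M" unfolding M_def by blast
    qed
    have "closed M"
      unfolding closed_sequential_limits
    proof (intro allI impI, elim conjE)
      fix f y assume f: "\<forall>n. f n \<in> M" and fy: "f \<longlonglongrightarrow> y"
      have "\<forall>n. \<exists>x u. T x = Some u \<and> f n = u - z *\<^sub>C x" using f unfolding M_def by blast
      then obtain x u where xu: "\<And>n. T (x n) = Some (u n)" "\<And>n. f n = u n - z *\<^sub>C x n" by metis
      have fC: "Cauchy f" using fy LIMSEQ_imp_Cauchy by blast
      have "Cauchy x"
      proof (rule CauchyI)
        fix r :: real assume r: "r > 0"
        have "e * r > 0" using e(1) r by simp
        then obtain N where N: "\<forall>m\<ge>N. \<forall>n\<ge>N. norm (f m - f n) < e * r" using CauchyD[OF fC] by blast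
        have "norm (x m - x n) < r" if "m \<ge> N" "n \<ge> N" for m n
        proof -
          have "norm (x m - x n) \<le> (1 / e) * norm (f m - f n)" unfolding xu(2) by (rule d) (rule xu)+
          also have "\<dots> < (1 / e) * (e * r)" using N that e(1) by (intro mult_strict_left_mono) auto
          finally show ?thesis using e(1) by simp
        qed
        then show "\<exists>N. \<forall>m\<ge>N. \<forall>n\<ge>N. norm (x m - x n) < r" by blast
      qed
      then obtain p where p: "x \<longlonglongrightarrow> p" using convergent_eq_Cauchy by blast
      have "(\<lambda>n. f n + z *\<^sub>C x n) \<longlonglongrightarrow> y + z *\<^sub>C p"
        by (intro tendsto_add fy bounded_linear.tendsto[OF bounded_linear_scaleC p])
      then have "u \<longlonglongrightarrow> y + z *\<^sub>C p" by (simp add: xu(2))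
      then have "p \<in> dom T \<and> the (T p) = y + z *\<^sub>C p"
        using p by (intro closed_graph[of x]) (auto simp: xu(1))
      then obtain w where "T p = Some w" "y = w - z *\<^sub>C p" by auto
      then show "y \<in> M" unfolding M_def by blast
    qed
    have "closure M = UNIV"
    proof (rule dense_subspace_if_orthogonal_trivial[OF subM])
      fix w assume w: "\<And>m. m \<in> M \<Longrightarrow> inner w m = 0"
      have "w \<in> dom T \<and> the (T w) = cnj z *\<^sub>C w"
      proof (rule maximal)
        fix x assume "x \<in> dom T"
        then obtain u where u: "T x = Some u" by blast
        then have "inner w (u - z *\<^sub>C x) = 0" using w unfolding M_def by blast
        then show "inner w (the (T x)) = inner (cnj z *\<^sub>C w) x"
          using u by (simp add: inner_diff_right inner_scaleC_left)
      qed
      then have Tw: "T w = Some (cnj z *\<^sub>C w)" by auto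
      have "(norm (cnj z *\<^sub>C w - z *\<^sub>C w))\<^sup>2 = (norm (cnj z *\<^sub>C w - cnj z *\<^sub>C w))\<^sup>2"
        unfolding self_adjoint_norm_shift[OF T Tw] by simp
      then have "e * norm w \<le> 0" using e(2)[OF Tw] by simp
      then show "w = 0" using e(1) by (simp add: mult_le_0_iff)
    qed
    then have M: "M = UNIV" using \<open>closed M\<close> by (simp add: closure_closed)
    have "\<exists>x. \<exists>u. T x = Some u \<and> u - z *\<^sub>C x = y" for y
    proof -
      have "y \<in> M" using M by simp
      then show ?thesis unfolding M_def by blast
    qed
    then obtain B where B: "\<And>y. \<exists>u. T (B y) = Some u \<and> u - z *\<^sub>C B y = y" by metis
    have BI: "B (u - z *\<^sub>C x) = x" if x: "T x = Some u" for x u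
    proof -
      obtain v where v: "T (B (u - z *\<^sub>C x)) = Some v" "v - z *\<^sub>C B (u - z *\<^sub>C x) = u - z *\<^sub>C x" using B by blast
      show ?thesis using d[OF v(1) x] v(2) by simp
    qed
    have "bounded_linear B"
    proof (rule bounded_linear_intro)
      fix y y' :: 'a and r :: real
      obtain v v' where v: "T (B y) = Some v" "v - z *\<^sub>C B y = y" and v': "T (B y') = Some v'" "v' - z *\<^sub>C B y' = y'"
        using B[of y] B[of y'] by blast
      have "B ((v + v') - z *\<^sub>C (B y + B y')) = B y + B y'" by (rule BI[OF l(2)[OF v(1) v'(1)]])
      moreover have "(v + v') - z *\<^sub>C (B y + B y') = (v - z *\<^sub>C B y) + (v' - z *\<^sub>C B y')"
        by (simp add: scaleC_add_right)
      ultimately show "B (y + y') = B y + B y'" by (simp only: v(2) v'(2))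
      have "B (r *\<^sub>R v - z *\<^sub>C (r *\<^sub>R B y)) = r *\<^sub>R B y" by (rule BI[OF l(4)[OF v(1)]])
      moreover have "r *\<^sub>R v - z *\<^sub>C (r *\<^sub>R B y) = r *\<^sub>R (v - z *\<^sub>C B y)"
        by (simp add: scaleC_scaleR algebra_simps)
      ultimately show "B (r *\<^sub>R y) = r *\<^sub>R B y" by (simp only: v(2))
      show "norm (B y) \<le> norm y * (1 / e)" using e(2)[OF v(1)] v(2) e(1) by (simp add: field_simps)
    qed
    then show ?L using B BI by blast
  qed
  finally show ?thesis .
qed

lemma spectrum_real:
  assumes T: "self_adjoint T" and z: "z \<in> spectrum T"
  shows "z = complex_of_real (Re z)"
proof (rule ccontr)
  assume "z \<noteq> complex_of_real (Re z)"
  then have "Im z \<noteq> 0" by (auto simp: complex_eq_iff)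
  moreover have "\<bar>Im z\<bar> * norm x \<le> norm (u - z *\<^sub>C x)" if "T x = Some u" for x u
    by (rule power2_le_imp_le) (simp_all add: self_adjoint_norm_shift[OF T that] power_mult_distrib)
  ultimately have "z \<in> resolvent_set T" unfolding resolvent_set_iff[OF T]
    by (intro exI[of _ "\<bar>Im z\<bar>"]) simp
  then show False using z by (simp add: spectrum_def)
qed

lemma point_spectrum_subset_spectrum:
  assumes T: "self_adjoint T"
  shows "point_spectrum T \<subseteq> spectrum T"
proof
  fix z assume "z \<in> point_spectrum T"
  then obtain x where x: "x \<noteq> 0" "T x = Some (z *\<^sub>C x)" by (auto simp: point_spectrum_def)
  have "z \<notin> resolvent_set T"
  proof
    assume "z \<in> resolvent_set T"
    then obtain e where "e > 0" "e * norm x \<le> norm (z *\<^sub>C x - z *\<^sub>C x)"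
      unfolding resolvent_set_iff[OF T] using x(2) by blast
    then show False using x(1) by (simp add: mult_le_0_iff)
  qed
  then show "z \<in> spectrum T" by (simp add: spectrum_def)
qed

lemma spectrum_total_iff:
  assumes "self_adjoint (Some \<circ> S)"
  shows "complex_of_real \<mu> \<in> spectrum (Some \<circ> S) \<longleftrightarrow> \<not> expansive (\<lambda>x. S x - \<mu> *\<^sub>R x)"
  by (simp add: spectrum_def resolvent_set_iff[OF assms] expansive_def scaleC_of_real)

text \<open>The bound for \<open>T\<close> is relative to the domain vector \<open>C x\<close>, the
  other to the parameter \<open>x\<close>. They agree because |x| \<le> |C x| + |S x|, and
  \<open>S x\<close> is the shift plus t times \<open>C x\<close>.\<close>

lemma expansive_graph_iff:
  fixes C S :: "'a::real_inner \<Rightarrow> 'a"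
  assumes C: "symmetric_map C" and S: "symmetric_map S" and sq: "\<And>x. S (S x) + C (C x) = x"
  shows "(\<exists>e>0. \<forall>x. e * norm (C x) \<le> norm (S x - t *\<^sub>R C x)) \<longleftrightarrow> expansive (\<lambda>x. S x - t *\<^sub>R C x)"
proof
  note nle = norm_cos_sin_le[OF C S sq]
  show "\<exists>e>0. \<forall>x. e * norm (C x) \<le> norm (S x - t *\<^sub>R C x)" if "expansive (\<lambda>x. S x - t *\<^sub>R C x)"
    using that nle(1) unfolding expansive_def by (meson less_imp_le mult_left_mono order_trans)
  assume "\<exists>e>0. \<forall>x. e * norm (C x) \<le> norm (S x - t *\<^sub>R C x)"
  then obtain e where e: "e > 0" "\<And>x. e * norm (C x) \<le> norm (S x - t *\<^sub>R C x)" by blast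
  have "norm x \<le> ((1 + \<bar>t\<bar>) / e + 1) * norm (S x - t *\<^sub>R C x)" for x
  proof -
    have "(norm x)\<^sup>2 \<le> (norm (C x) + norm (S x))\<^sup>2" unfolding nle(3)[of x] by (simp add: power2_sum)
    then have "norm x \<le> norm (C x) + norm (S x)" by (rule power2_le_imp_le) simp
    moreover have "norm (S x) \<le> norm (S x - t *\<^sub>R C x) + \<bar>t\<bar> * norm (C x)"
      using norm_triangle_ineq[of "S x - t *\<^sub>R C x" "t *\<^sub>R C x"] by simp
    moreover have "(1 + \<bar>t\<bar>) * norm (C x) \<le> (1 + \<bar>t\<bar>) * (norm (S x - t *\<^sub>R C x) / e)"
      using e by (intro mult_left_mono) (auto simp: field_simps)
    ultimately show ?thesis by (simp add: algebra_simps)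
  qed
  moreover have "(1 + \<bar>t\<bar>) / e + 1 > 0" using e(1) by (simp add: add_nonneg_pos)
  ultimately show "expansive (\<lambda>x. S x - t *\<^sub>R C x)" unfolding expansive_def
    by (intro exI[of _ "1 / ((1 + \<bar>t\<bar>) / e + 1)"]) (simp add: divide_le_eq mult.commute)
qed

text \<open>A perturbation of the shift below half the lower bound leaves the other half.\<close>

lemma closed_nonexpansive_shifts:
  fixes S :: "'a::real_normed_vector \<Rightarrow> 'a"
  shows "closed {\<mu>. \<not> expansive (\<lambda>x. S x - \<mu> *\<^sub>R x)}"
proof -
  have "open {\<mu>. expansive (\<lambda>x. S x - \<mu> *\<^sub>R x)}"
    unfolding open_dist
  proof safe
    fix m assume "expansive (\<lambda>x. S x - m *\<^sub>R x)"
    then obtain e where e: "e > 0" "\<And>x. e * norm x \<le> norm (S x - m *\<^sub>R x)" unfolding expansive_def by blast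
    have "expansive (\<lambda>x. S x - n *\<^sub>R x)" if n: "dist n m < e / 2" for n
      unfolding expansive_def
    proof (intro exI[of _ "e / 2"] conjI allI)
      fix x
      have "norm (S x - m *\<^sub>R x) \<le> norm (S x - n *\<^sub>R x) + norm ((n - m) *\<^sub>R x)"
        using norm_triangle_ineq[of "S x - n *\<^sub>R x" "(n - m) *\<^sub>R x"] by (simp add: algebra_simps)
      moreover have "norm ((n - m) *\<^sub>R x) \<le> e / 2 * norm x"
        using mult_right_mono[of "\<bar>n - m\<bar>" "e / 2" "norm x"] n by (simp add: dist_real_def)
      ultimately show "e / 2 * norm x \<le> norm (S x - n *\<^sub>R x)" using e(2)[of x] by simp
    qed (use e in simp)
    then show "\<exists>d>0. \<forall>n. dist n m < d \<longrightarrow> n \<in> {\<mu>. expansive (\<lambda>x. S x - \<mu> *\<^sub>R x)}" using e(1) by (intro exI[of _ "e/2"]) simp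
  qed
  then show ?thesis by (simp add: closed_def Collect_neg_eq)
qed

text \<open>Only the endpoints need an argument: if 1 were isolated, the shift there would be
  bounded below. The endpoint -1 is treated through -S.\<close>

lemma nonexpansive_shifts_eq_closure:
  fixes S :: "'a::{real_inner,banach} \<Rightarrow> 'a"
  assumes S: "symmetric_map S" and contr: "\<And>x. norm (S x) \<le> norm x"
    and pure: "\<And>x. norm (S x) = norm x \<Longrightarrow> x = 0"
  shows "{\<mu>. \<not> expansive (\<lambda>x. S x - \<mu> *\<^sub>R x)} = closure {\<mu>. \<mu> \<in> {-1<..<1} \<and> \<not> expansive (\<lambda>x. S x - \<mu> *\<^sub>R x)}"
    (is "?P = closure ?F")
proof
  show "closure ?F \<subseteq> ?P" by (intro closure_minimal closed_nonexpansive_shifts) auto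
  have endpoint: "1 \<in> closure {\<mu>. \<mu> \<in> {-1<..<1} \<and> \<not> expansive (\<lambda>x. R x - \<mu> *\<^sub>R x)}"
    if R: "symmetric_map R" "\<And>x. norm (R x) = norm (S x)" and 1: "\<not> expansive (\<lambda>x. R x - x)" for R
  proof (rule ccontr)
    assume "1 \<notin> closure {\<mu>. \<mu> \<in> {-1<..<1} \<and> \<not> expansive (\<lambda>x. R x - \<mu> *\<^sub>R x)}" (is "1 \<notin> closure ?G")
    then obtain d where d: "d > 0" "\<And>y. y \<in> ?G \<Longrightarrow> d \<le> dist y 1"
      unfolding closure_approachable by (meson not_le)
    have "expansive (\<lambda>x. R x - x)"
    \<comment> \<open>This left end keeps the gap inside (-1, 1) and within distance
      \<open>d\<close> of 1.\<close>
    proof (rule expansive_at_isolated_endpoint[OF R(1), of "max (-1) (1 - d)"])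
      show "inner (R x) x \<le> (norm x)\<^sup>2" for x
      proof -
        have "inner (R x) x \<le> norm (R x) * norm x" by (rule norm_cauchy_schwarz)
        also have "\<dots> \<le> norm x * norm x" using contr by (intro mult_right_mono) (auto simp: R(2))
        finally show ?thesis by (simp add: power2_eq_square)
      qed
      show "max (-1) (1 - d) < 1" using d(1) by simp
      show "expansive (\<lambda>x. R x - t *\<^sub>R x)" if "max (-1) (1 - d) < t" "t < 1" for t
      proof (rule ccontr)
        assume "\<not> ?thesis"
        then have "t \<in> ?G" using that by simp
        from d(2)[OF this] show False using that by (simp add: dist_real_def)
      qed
      show "x = 0" if "R x = x" for x using pure[of x] R(2)[of x] that by simp
    qed
    then show False using 1 by simp
  qed
  show "?P \<subseteq> closure ?F"
  proof
    fix m assume m: "m \<in> ?P"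
    have "\<bar>m\<bar> \<le> 1"
    proof (rule ccontr)
      assume gt: "\<not> ?thesis"
      have "(\<bar>m\<bar> - 1) * norm x \<le> norm (S x - m *\<^sub>R x)" for x
        using contr[of x] norm_triangle_ineq2[of "m *\<^sub>R x" "S x"]
        by (simp add: norm_minus_commute left_diff_distrib)
      then have "expansive (\<lambda>x. S x - m *\<^sub>R x)" unfolding expansive_def using gt
        by (intro exI[of _ "\<bar>m\<bar> - 1"]) simp
      then show False using m by simp
    qed
    then consider "m \<in> {-1<..<1}" | "m = 1" | "m = -1" by fastforce
    then show "m \<in> closure ?F"
    proof cases
      case 1
      then have "m \<in> ?F" using m by simp
      then show ?thesis by (rule subsetD[OF closure_subset])
    next
      case 2
      then show ?thesis using endpoint[OF S] m by simp
    next
      case 3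
      have flip: "expansive (\<lambda>x. - S x - t *\<^sub>R x) \<longleftrightarrow> expansive (\<lambda>x. S x - (- t) *\<^sub>R x)" for t
      proof -
        have "norm (- S x - t *\<^sub>R x) = norm (S x - (- t) *\<^sub>R x)" for x
        proof -
          have "- S x - t *\<^sub>R x = - (S x - (- t) *\<^sub>R x)" by simp
          then show ?thesis by (simp only: norm_minus_cancel)
        qed
        then show ?thesis unfolding expansive_def by simp
      qed
      have "symmetric_map (\<lambda>x. - S x)" using symmetric_map_affine[OF S, of "-1" 0] by simp
      moreover have "\<not> expansive (\<lambda>x. - S x - x)" using flip[of 1] m 3 by simp
      ultimately have "1 \<in> closure {\<mu>. \<mu> \<in> {-1<..<1} \<and> \<not> expansive (\<lambda>x. - S x - \<mu> *\<^sub>R x)}"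
        using endpoint[of "\<lambda>x. - S x"] by simp
      also have "{\<mu>. \<mu> \<in> {-1<..<1} \<and> \<not> expansive (\<lambda>x. - S x - \<mu> *\<^sub>R x)} = uminus ` ?F"
        unfolding flip
      proof (intro set_eqI iffI)
        fix t assume "t \<in> {\<mu>. \<mu> \<in> {-1<..<1} \<and> \<not> expansive (\<lambda>x. S x - (- \<mu>) *\<^sub>R x)}"
        then have "- t \<in> ?F" by simp
        then show "t \<in> uminus ` ?F" by (rule rev_image_eqI) simp
      qed auto
      finally have 1: "1 \<in> closure (uminus ` ?F)" .
      show ?thesis unfolding 3 closure_approachable
      proof (intro allI impI)
        fix e :: real assume "e > 0"
        then obtain y where y: "y \<in> ?F" "dist (- y) 1 < e" using 1 unfolding closure_approachable by blast
        moreover have "dist y (-1) = dist (- y) 1" by (simp add: dist_real_def)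
        ultimately show "\<exists>y\<in>?F. dist y (-1) < e" by metis
      qed
    qed
  qed
qed

section \<open>The scalar transforms and the theorem\<close>

lemma powr_minus_half: "0 < a \<Longrightarrow> a powr (- 1 / 2) = 1 / sqrt a"
  by (simp add: powr_minus powr_half_sqrt inverse_eq_divide flip: minus_divide_left)

lemma transform_maps_inverse:
  fixes m t :: real
  shows "\<bar>m\<bar> < 1 \<Longrightarrow> (m / sqrt (1 - m\<^sup>2)) / sqrt (1 + (m / sqrt (1 - m\<^sup>2))\<^sup>2) = m"
    and "(t / sqrt (1 + t\<^sup>2)) / sqrt (1 - (t / sqrt (1 + t\<^sup>2))\<^sup>2) = t"
    and "\<bar>t / sqrt (1 + t\<^sup>2)\<bar> < 1"
proof -
  assume "\<bar>m\<bar> < 1"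
  then have p: "1 - m\<^sup>2 > 0" by (simp add: abs_square_less_1)
  then have "1 + (m / sqrt (1 - m\<^sup>2))\<^sup>2 = 1 / (1 - m\<^sup>2)" by (simp add: power_divide field_simps)
  then show "(m / sqrt (1 - m\<^sup>2)) / sqrt (1 + (m / sqrt (1 - m\<^sup>2))\<^sup>2) = m"
    using p by (simp add: real_sqrt_divide)
next
  have p: "1 + t\<^sup>2 > 0" by (simp add: add_pos_nonneg)
  then have "1 - (t / sqrt (1 + t\<^sup>2))\<^sup>2 = 1 / (1 + t\<^sup>2)" by (simp add: power_divide field_simps)
  then show "(t / sqrt (1 + t\<^sup>2)) / sqrt (1 - (t / sqrt (1 + t\<^sup>2))\<^sup>2) = t"
    using p by (simp add: real_sqrt_divide)
  have "(t / sqrt (1 + t\<^sup>2))\<^sup>2 < 1" using p by (simp add: power_divide field_simps)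
  then show "\<bar>t / sqrt (1 + t\<^sup>2)\<bar> < 1" by (simp add: abs_square_less_1)
qed

theorem theorem1:
  fixes T S :: "'a::complex_hilbert operator"
  assumes "self_adjoint T"
    and "S = bounded_transform T"
  shows "spectrum T =
      {complex_of_real (\<mu> * (1 - \<mu>\<^sup>2) powr (- 1 / 2)) | \<mu>.
        complex_of_real \<mu> \<in> spectrum S \<and> \<mu> \<in> {-1<..<1}} \<and>
    spectrum S =
      complex_of_real ` closure {t * (1 + t\<^sup>2) powr (- 1 / 2) | t.
        complex_of_real t \<in> spectrum T} \<and>
    point_spectrum T =
      {complex_of_real (\<mu> * (1 - \<mu>\<^sup>2) powr (- 1 / 2)) | \<mu>.
        complex_of_real \<mu> \<in> point_spectrum S \<and> \<mu> \<in> {-1<..<1}} \<and>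
    point_spectrum S =
      {complex_of_real (t * (1 + t\<^sup>2) powr (- 1 / 2)) | t.
        complex_of_real t \<in> point_spectrum T}"
proof -
  obtain C F where bt: "bounded_transform T = Some \<circ> F" and sa: "self_adjoint (Some \<circ> F)"
    and C: "symmetric_map C" "\<And>x. 0 \<le> inner (C x) x" and F: "symmetric_map F"
    and comm: "\<And>x. C (F x) = F (C x)" and sq: "\<And>x. F (F x) + C (C x) = x" and inj: "\<And>x. C x = 0 \<Longrightarrow> x = 0"
    and T: "\<And>y v. T y = Some v \<longleftrightarrow> (\<exists>x. y = C x \<and> v = F x)"
    by (rule bounded_transform_structure[OF assms(1)]) blast
  have S: "S = Some \<circ> F" using bt assms(2) by simp
  note sa = sa[folded S]
  note nle = norm_cos_sin_le[OF C(1) F sq]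
  have pure: "x = 0" if "norm (F x) = norm x" for x using nle(3)[of x] that inj by simp
  define f g :: "real \<Rightarrow> real" where "f t = t / sqrt (1 + t\<^sup>2)" and "g m = m / sqrt (1 - m\<^sup>2)" for t m
  have f: "t * (1 + t\<^sup>2) powr (- 1 / 2) = f t" for t
    using powr_minus_half[of "1 + t\<^sup>2"] by (simp add: f_def add_pos_nonneg)
  have g: "m * (1 - m\<^sup>2) powr (- 1 / 2) = g m" if "m \<in> {-1<..<1}" for m
    using that powr_minus_half[of "1 - m\<^sup>2"] by (simp add: g_def abs_square_less_1 abs_less_iff)
  have fg: "f (g m) = m" if "m \<in> {-1<..<1}" for m
    using transform_maps_inverse(1)[of m] that by (simp add: f_def g_def abs_less_iff)
  have gf: "g (f t) = t" "f t \<in> {-1<..<1}" for t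
    using transform_maps_inverse(2)[of t] transform_maps_inverse(3)[of t, unfolded abs_less_iff]
    unfolding f_def g_def by auto
  have spec: "complex_of_real (g m) \<in> spectrum T \<longleftrightarrow> complex_of_real m \<in> spectrum S"
    and pspec: "complex_of_real (g m) \<in> point_spectrum T \<longleftrightarrow> complex_of_real m \<in> point_spectrum S"
    if m: "m \<in> {-1<..<1}" for m
  proof -
    have "\<bar>m\<bar> < 1" using m by auto
    then obtain k K where k: "k > 0" "K > 0" "\<And>x. k * norm (F x - m *\<^sub>R x) \<le> norm (F x - g m *\<^sub>R C x)"
      "\<And>x. norm (F x - g m *\<^sub>R C x) \<le> K * norm (F x - m *\<^sub>R x)"
      using shift_comparison[OF C(1) F C(2) comm sq _ g_def] by blast
    have "complex_of_real (g m) \<notin> spectrum T \<longleftrightarrow> (\<exists>e>0. \<forall>x. e * norm (C x) \<le> norm (F x - g m *\<^sub>R C x))"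
      by (auto simp: spectrum_def resolvent_set_iff[OF assms(1)] T scaleC_of_real)
    also have "\<dots> \<longleftrightarrow> expansive (\<lambda>x. F x - g m *\<^sub>R C x)" by (rule expansive_graph_iff[OF C(1) F sq])
    also have "\<dots> \<longleftrightarrow> expansive (\<lambda>x. F x - m *\<^sub>R x)"
    proof
      assume "expansive (\<lambda>x. F x - g m *\<^sub>R C x)"
      then obtain e where e: "e > 0" "\<And>x. e * norm x \<le> norm (F x - g m *\<^sub>R C x)" unfolding expansive_def by blast
      have "e / K * norm x \<le> norm (F x - m *\<^sub>R x)" for x
        using order_trans[OF e(2) k(4)] k(2) by (simp add: field_simps)
      then show "expansive (\<lambda>x. F x - m *\<^sub>R x)" unfolding expansive_def using e(1) k(2)
        by (intro exI[of _ "e / K"]) simp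
    next
      assume "expansive (\<lambda>x. F x - m *\<^sub>R x)"
      then obtain e where e: "e > 0" "\<And>x. e * norm x \<le> norm (F x - m *\<^sub>R x)" unfolding expansive_def by blast
      have "k * e * norm x \<le> norm (F x - g m *\<^sub>R C x)" for x
        using order_trans[OF mult_left_mono[OF e(2)] k(3)] k(1) by (simp only: mult.assoc less_imp_le)
      then show "expansive (\<lambda>x. F x - g m *\<^sub>R C x)" unfolding expansive_def using e(1) k(1)
        by (intro exI[of _ "k * e"]) simp
    qed
    also have "\<dots> \<longleftrightarrow> complex_of_real m \<notin> spectrum S"
      using spectrum_total_iff[OF sa[unfolded S]] by (simp add: S)
    finally show "complex_of_real (g m) \<in> spectrum T \<longleftrightarrow> complex_of_real m \<in> spectrum S" by blast
    \<comment> \<open>The two-sided comparison makes both sides vanish together.\<close>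
    have kernel: "F x = g m *\<^sub>R C x \<longleftrightarrow> F x = m *\<^sub>R x" for x
      using k(3)[of x] k(4)[of x] k(1) by (auto simp: mult_le_0_iff)
    have "complex_of_real (g m) \<in> point_spectrum T \<longleftrightarrow> (\<exists>x. C x \<noteq> 0 \<and> F x = g m *\<^sub>R C x)"
      unfolding point_spectrum_def mem_Collect_eq T scaleC_of_real by metis
    \<comment> \<open>Eigenvectors correspond by x to C x, nonzero together by injectivity of
      \<open>C\<close>.\<close>
    also have "\<dots> \<longleftrightarrow> (\<exists>x. x \<noteq> 0 \<and> F x = m *\<^sub>R x)"
      using inj symmetric_mapD(6)[OF C(1)] unfolding kernel by metis
    also have "\<dots> \<longleftrightarrow> complex_of_real m \<in> point_spectrum S"
      by (simp add: S point_spectrum_def scaleC_of_real)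
    finally show "complex_of_real (g m) \<in> point_spectrum T \<longleftrightarrow> complex_of_real m \<in> point_spectrum S" .
  qed
  \<comment> \<open>Pure bookkeeping with the bijection \<open>g\<close>, kept generic to serve both
    spectra and point spectra.\<close>
  have T_eq: "X = {complex_of_real (m * (1 - m\<^sup>2) powr (- 1 / 2)) | m. complex_of_real m \<in> Y \<and> m \<in> {-1<..<1}}"
    if X: "\<And>z. z \<in> X \<Longrightarrow> z = complex_of_real (Re z)"
      and XY: "\<And>m. m \<in> {-1<..<1} \<Longrightarrow> complex_of_real (g m) \<in> X \<longleftrightarrow> complex_of_real m \<in> Y" for X Y
  proof (intro set_eqI iffI)
    fix z assume z: "z \<in> X"
    let ?m = "f (Re z)"
    have "z = complex_of_real (g ?m)" using X[OF z] by (simp add: gf)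
    moreover have "complex_of_real ?m \<in> Y" using XY[OF gf(2)] z calculation by metis
    ultimately show "z \<in> {complex_of_real (m * (1 - m\<^sup>2) powr (- 1 / 2)) | m. complex_of_real m \<in> Y \<and> m \<in> {-1<..<1}}"
      using gf(2) g by (intro CollectI exI[of _ ?m]) auto
  next
    fix z assume "z \<in> {complex_of_real (m * (1 - m\<^sup>2) powr (- 1 / 2)) | m. complex_of_real m \<in> Y \<and> m \<in> {-1<..<1}}"
    then obtain m where m: "complex_of_real m \<in> Y" "m \<in> {-1<..<1}" and z: "z = complex_of_real (m * (1 - m\<^sup>2) powr (- 1 / 2))"
      by blast
    show "z \<in> X" unfolding z g[OF m(2)] using XY[OF m(2)] m(1) by blast
  qed
  have image: "{t * (1 + t\<^sup>2) powr (- 1 / 2) | t. complex_of_real t \<in> X} = {m. m \<in> {-1<..<1} \<and> complex_of_real m \<in> Y}"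
    if XY: "\<And>m. m \<in> {-1<..<1} \<Longrightarrow> complex_of_real (g m) \<in> X \<longleftrightarrow> complex_of_real m \<in> Y" for X Y
  proof (intro set_eqI iffI)
    fix m assume "m \<in> {t * (1 + t\<^sup>2) powr (- 1 / 2) | t. complex_of_real t \<in> X}"
    then obtain t where t: "m = f t" "complex_of_real t \<in> X" unfolding f by blast
    then show "m \<in> {m. m \<in> {-1<..<1} \<and> complex_of_real m \<in> Y}" using XY[OF gf(2)[of t]] gf by simp
  next
    fix m assume m: "m \<in> {m. m \<in> {-1<..<1} \<and> complex_of_real m \<in> Y}"
    then have "m = f (g m)" "complex_of_real (g m) \<in> X" using XY fg by simp_all
    then show "m \<in> {t * (1 + t\<^sup>2) powr (- 1 / 2) | t. complex_of_real t \<in> X}" unfolding f by blast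
  qed
  have realS: "Z = complex_of_real ` {m. complex_of_real m \<in> Z}" if "Z \<subseteq> spectrum S" for Z
    using spectrum_real[OF sa] that by (auto simp: image_iff) (metis subsetD)
  have "spectrum T = {complex_of_real (m * (1 - m\<^sup>2) powr (- 1 / 2)) | m.
      complex_of_real m \<in> spectrum S \<and> m \<in> {-1<..<1}}"
    by (rule T_eq) (fact spectrum_real[OF assms(1)], fact spec)
  moreover have "spectrum S = complex_of_real ` closure {t * (1 + t\<^sup>2) powr (- 1 / 2) | t. complex_of_real t \<in> spectrum T}"
  proof -
    have "spectrum S = complex_of_real ` {m. complex_of_real m \<in> spectrum S}" by (rule realS) simp
    also have "{m. complex_of_real m \<in> spectrum S} = closure {m. m \<in> {-1<..<1} \<and> complex_of_real m \<in> spectrum S}"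
      using nonexpansive_shifts_eq_closure[OF F nle(2)] pure spectrum_total_iff[OF sa[unfolded S]] by (simp add: S)
    also have "{m. m \<in> {-1<..<1} \<and> complex_of_real m \<in> spectrum S} =
        {t * (1 + t\<^sup>2) powr (- 1 / 2) | t. complex_of_real t \<in> spectrum T}"
      by (rule image[symmetric]) (fact spec)
    finally show ?thesis .
  qed
  moreover have "point_spectrum T = {complex_of_real (m * (1 - m\<^sup>2) powr (- 1 / 2)) | m.
      complex_of_real m \<in> point_spectrum S \<and> m \<in> {-1<..<1}}"
    using point_spectrum_subset_spectrum[OF assms(1)] spectrum_real[OF assms(1)] by (intro T_eq pspec) blast
  moreover have "point_spectrum S = {complex_of_real (t * (1 + t\<^sup>2) powr (- 1 / 2)) | t. complex_of_real t \<in> point_spectrum T}"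
  proof -
    \<comment> \<open>Purity of the contraction keeps eigenvalues off the endpoints, so the point
      spectrum requires no closure.\<close>
    have "m \<in> {-1<..<1}" if "complex_of_real m \<in> point_spectrum S" for m
    proof -
      have "\<exists>x. x \<noteq> 0 \<and> F x = m *\<^sub>R x" using that by (simp add: S point_spectrum_def scaleC_of_real)
      then obtain x where x: "x \<noteq> 0" "F x = m *\<^sub>R x" by blast
      have "norm (F x) < norm x" using nle(2)[of x] pure[of x] x(1) by fastforce
      then have "\<bar>m\<bar> < 1" using x by (simp add: mult_less_cancel_right2)
      then show ?thesis by auto
    qed
    then have "{m. complex_of_real m \<in> point_spectrum S} = {m. m \<in> {-1<..<1} \<and> complex_of_real m \<in> point_spectrum S}"
      by blast
    also have "\<dots> = {t * (1 + t\<^sup>2) powr (- 1 / 2) | t. complex_of_real t \<in> point_spectrum T}"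
      by (rule image[symmetric]) (fact pspec)
    finally have "point_spectrum S = complex_of_real ` {t * (1 + t\<^sup>2) powr (- 1 / 2) | t. complex_of_real t \<in> point_spectrum T}"
      using realS[OF point_spectrum_subset_spectrum[OF sa]] by simp
    then show ?thesis by blast
  qed
  ultimately show ?thesis by blast
qed

end
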